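(* Let $p\in\mathbb{R}$, $p\ge2$, let $\beta>1/2$, and let $\phi:[0,\infty)\to\mathbb{R}$ be a $(p,\beta)$-function. Then $\phi$ admits a limiting distribution $\mu$, and: (i) if $\beta<1$, there is a constant $C>0$ (depending on $\phi$) such that for all $S\ge1$ $$\mu\big((-\infty,-S]\cup[S,+\infty)\big)\le C\,S^{-(2\beta-1)/(2-2\beta)};$$ (ii) if $\beta=1$, there are constants $c_\phi>0$ and $C>0$ such that for all $S\ge1$ $$\mu\big((-\infty,-S]\cup[S,+\infty)\big)\le C\exp(-c_\phi S);$$ (iii) if $\beta>1$, the measure $\mu$ is compactly supported.
   Context: Let $p\in\mathbb{R}$, $p\ge 1$. A (Lebesgue measurable) function $\phi:[0,\infty)\to\mathbb{R}$ is called a $p$-function if there exist a strictly increasing sequence $\{\lambda_n\}_{n\ge1}$ of positive real numbers tending to infinity, a sequence $\{r_n\}_{n\ge1}$ of complex numbers, and numbers $y_0,X_0>0$ such that $\phi\in L^p([0,y_0])$ and, for all $y\ge y_0$ and $X\ge X_0$, $$\phi(y)=2\Re\Big(\sum_{0<\lambda_n\le X}r_ne^{i\lambda_ny}\Big)+\mathcal{E}(y,X),$$ where $\mathcal{E}(y,X)$ satisfies $$\lim_{Y\to\infty}\frac1Y\int_{y_0}^Y|\mathcal{E}(y,X(Y))|^p\,dy=0$$ for some non-decreasing function $X(Y)$ tending to infinity as $Y\to\infty$. If moreover there is $\beta\in\mathbb{R}$ such that $\sum_{T\le\lambda_n\le T+1}|r_n|\ll T^{-\beta}$ for $T\gg1$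 (i.e. there are constants $C,T_0>0$ with $\sum_{T\le\lambda_n\le T+1}|r_n|\le CT^{-\beta}$ for all $T\ge T_0$), then $\phi$ is called a $(p,\beta)$-function. A limiting distribution for a function $\phi:[0,\infty)\to\mathbb{R}$ is a probability measure $\mu$ on $\mathbb{R}$ such that $$\lim_{Y\to\infty}\frac1Y\int_0^Yg(\phi(y))\,dy=\int_{\mathbb{R}}g\,d\mu$$ for every bounded continuous function $g$ on $\mathbb{R}$. *)

theory Defs
  imports "HOL-Probability.Probability"
begin

text \<open>
  A function on \<open>[0, \<infinity>)\<close> is represented by \<open>\<phi> :: real \<Rightarrow> real\<close>; only its values on \<^term>\<open>{0::real..}\<close>
  are ever used. The sequences are indexed from \<open>0\<close> instead of \<open>1\<close>.

  \<open>p_function_expansion p \<phi> lam r y0 X0\<close>: \<open>\<phi>\<close> is a \<open>p\<close>-function, witnessed by the given frequencies,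
  coefficients and thresholds. The integral of \<open>\<bar>E\<bar>\<^sup>p\<close> takes values in \<open>[0, \<infinity>]\<close>, so that the limit
  being \<open>0\<close> entails integrability for large \<open>Y\<close> (a Bochner integral would be \<open>0\<close> for a
  non-integrable integrand). The values \<open>E y X\<close> with \<open>X < X0\<close> are unconstrained, but
  \<open>Xf Y \<ge> X0\<close> for large \<open>Y\<close>, so they do not influence the limit.
\<close>

definition p_function_expansion ::
  "real \<Rightarrow> (real \<Rightarrow> real) \<Rightarrow> (nat \<Rightarrow> real) \<Rightarrow> (nat \<Rightarrow> complex) \<Rightarrow> real \<Rightarrow> real \<Rightarrow> bool" where
  "p_function_expansion p \<phi> lam r y0 X0 \<longleftrightarrow>
     1 \<le> p \<and>
     \<phi> \<in> borel_measurable (lebesgue_on {0..}) \<and>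
     (\<forall>n. 0 < lam n) \<and> strict_mono lam \<and> filterlim lam at_top sequentially \<and>
     0 < y0 \<and> 0 < X0 \<and>
     set_integrable lebesgue {0..y0} (\<lambda>y. \<bar>\<phi> y\<bar> powr p) \<and>
     (\<exists>E :: real \<Rightarrow> real \<Rightarrow> real.
        (\<forall>y\<ge>y0. \<forall>X\<ge>X0.
           \<phi> y = 2 * Re (\<Sum>n | 0 < lam n \<and> lam n \<le> X. r n * exp (\<i> * complex_of_real (lam n * y)))
                 + E y X) \<and>
        (\<exists>Xf :: real \<Rightarrow> real.
           mono_on {y0..} Xf \<and> filterlim Xf at_top at_top \<and>
           ((\<lambda>Y. ennreal (1 / Y) * (\<integral>\<^sup>+ y\<in>{y0..Y}. ennreal (\<bar>E y (Xf Y)\<bar> powr p) \<partial>lebesgue))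
              \<longlongrightarrow> 0) at_top))"

definition p_function :: "real \<Rightarrow> (real \<Rightarrow> real) \<Rightarrow> bool" where
  "p_function p \<phi> \<longleftrightarrow> (\<exists>lam r y0 X0. p_function_expansion p \<phi> lam r y0 X0)"

definition p_beta_function :: "real \<Rightarrow> real \<Rightarrow> (real \<Rightarrow> real) \<Rightarrow> bool" where
  "p_beta_function p \<beta> \<phi> \<longleftrightarrow>
     (\<exists>lam r y0 X0. p_function_expansion p \<phi> lam r y0 X0 \<and>
        (\<exists>C>0. \<exists>T0>0. \<forall>T\<ge>T0.
           (\<Sum>n | T \<le> lam n \<and> lam n \<le> T + 1. norm (r n)) \<le> C * T powr (- \<beta>)))"

text \<open>
  If \<open>\<phi>\<close> is Lebesgue measurable on \<open>[0, \<infinity>)\<close>, as every \<open>p\<close>-function is, then \<open>g \<circ> \<phi>\<close> is bounded and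
  measurable, so the integrals over \<open>[0, Y]\<close> below exist.
\<close>

definition limiting_distribution :: "(real \<Rightarrow> real) \<Rightarrow> real measure \<Rightarrow> bool" where
  "limiting_distribution \<phi> \<mu> \<longleftrightarrow>
     real_distribution \<mu> \<and>
     (\<forall>g :: real \<Rightarrow> real. continuous_on UNIV g \<and> bounded (range g) \<longrightarrow>
        ((\<lambda>Y. 1 / Y * (LINT y:{0..Y}|lebesgue. g (\<phi> y))) \<longlongrightarrow> (LINT x|\<mu>. g x)) at_top)"

definition measure_support :: "'a::topological_space measure \<Rightarrow> 'a set" where
  "measure_support \<mu> = {x. \<forall>U. open U \<and> x \<in> U \<longrightarrow> 0 < emeasure \<mu> U}"

definition compactly_supported :: "'a::topological_space measure \<Rightarrow> bool" where
  "compactly_supported \<mu> \<longleftrightarrow> compact (measure_support \<mu>)"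

end

theory Submission
  imports Defs
begin

text \<open>
  Let \<open>P_T\<close> be the partial sum of \<open>\<phi>\<close> over the frequencies up to \<open>T\<close>. A large sieve type
  inequality with a triangular weight bounds the mean square of \<open>P_X - P_T\<close> over \<open>[0, Y]\<close> by a
  multiple of the sum over \<open>k \<ge> T\<close> of \<open>A_k\<^sup>2\<close>, where \<open>A_k = O(k\<^bsup>-\<beta>\<^esup>)\<close> is the mass of the coefficients
  with frequency in \<open>[k, k + 1)\<close>. As \<open>p \<ge> 2\<close> the error term is negligible in mean square, so the upper
  mean of \<open>(\<phi> - P_T)\<^sup>2\<close> is \<open>O(T\<^bsup>1-2\<beta>\<^esup>)\<close>. Since \<open>exp(i t P_T)\<close> is a uniform limit of trigonometric
  polynomials it has a mean, whence the characteristic functions of the empirical laws of \<open>\<phi>\<close> converge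
  and Helly's and Levy's theorems yield \<open>\<mu>\<close>. If \<open>\<bar>P_T\<bar> \<le> S - 1\<close> everywhere, then Chebyshev's inequality
  bounds the tail of \<open>\<mu>\<close> at \<open>S\<close> by \<open>O(T\<^bsup>1-2\<beta>\<^esup>)\<close>; the three cases result from choosing the largest such
  \<open>T\<close>, because \<open>P_T\<close> is \<open>O(T\<^bsup>1-\<beta>\<^esup>)\<close>, \<open>O(1 + ln T)\<close> or \<open>O(1)\<close>.
\<close>

section \<open>Mean squares of trigonometric sums\<close>

lemma sum_inverse_squares_le:
  assumes "finite (D :: nat set)"
  shows "(\<Sum>d\<in>D. 1 / (real d + 1)^2) \<le> 2"
proof -
  \<comment> \<open>The subtracted term \<open>1 / (n + 1)\<close> makes the induction work: the
    next summand is at most \<open>1 / (n + 1) - 1 / (n + 2)\<close>, so the bound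
    telescopes.\<close>
  have partial: "(\<Sum>d\<le>n. 1 / (real d + 1)^2) \<le> 2 - 1 / (real n + 1)" for n
  proof (induction n)
    case (Suc n)
    have "1 / (real (Suc n) + 1)^2 \<le> 1 / ((real n + 1) * (real n + 2))"
      by (intro divide_left_mono mult_pos_pos zero_less_power) (simp_all add: power2_eq_square algebra_simps)
    also have "\<dots> = 1 / (real n + 1) - 1 / (real (Suc n) + 1)"
      by (simp add: divide_simps)
    finally show ?case using Suc by simp
  qed simp
  obtain n where "\<forall>d\<in>D. d \<le> n" using assms unfolding finite_nat_set_iff_bounded_le by (rule exE)
  then have "D \<subseteq> {..n}" by auto
  then have "(\<Sum>d\<in>D. 1 / (real d + 1)^2) \<le> (\<Sum>d\<le>n. 1 / (real d + 1)^2)"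
    by (intro sum_mono2) auto
  also have "\<dots> \<le> 2" using partial[of n] by (smt (verit) divide_nonneg_nonneg of_nat_0_le_iff)
  finally show ?thesis .
qed

text \<open>On either side of \<open>k\<close> the distances to \<open>k\<close> are distinct
  natural numbers, so each side is a sum of inverse squares over a finite set and contributes at
  most 2.\<close>

lemma sum_inverse_square_distances_le:
  assumes "finite (F :: nat set)"
  shows "(\<Sum>l\<in>F. 1 / (\<bar>real k - real l\<bar> + 1)^2) \<le> 4"
proof -
  have "(\<Sum>l\<in>F. 1 / (\<bar>real k - real l\<bar> + 1)^2) =
      (\<Sum>l\<in>F \<inter> {..k}. 1 / (\<bar>real k - real l\<bar> + 1)^2) + (\<Sum>l\<in>F - {..k}. 1 / (\<bar>real k - real l\<bar> + 1)^2)"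
    using assms by (metis sum.Int_Diff)
  also have "(\<Sum>l\<in>F \<inter> {..k}. 1 / (\<bar>real k - real l\<bar> + 1)^2) =
      (\<Sum>d\<in>(\<lambda>l. k - l) ` (F \<inter> {..k}). 1 / (real d + 1)^2)"
    by (subst sum.reindex) (auto simp: inj_on_def of_nat_diff intro!: sum.cong)
  also have "\<dots> \<le> 2" using assms by (intro sum_inverse_squares_le) auto
  also have "(\<Sum>l\<in>F - {..k}. 1 / (\<bar>real k - real l\<bar> + 1)^2) =
      (\<Sum>d\<in>(\<lambda>l. l - k) ` (F - {..k}). 1 / (real d + 1)^2)"
    by (subst sum.reindex) (auto simp: inj_on_def of_nat_diff intro!: sum.cong)
  also have "\<dots> \<le> 2" using assms by (intro sum_inverse_squares_le) auto
  finally show ?thesis by simp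
qed

text \<open>Schur test: the kernel is symmetric and nonnegative with row sums at most 4, and
  \<open>A k * A l\<close> is at most the mean of the two squares.\<close>

lemma schur_inverse_square_distances:
  fixes A :: "nat \<Rightarrow> real"
  assumes "finite F"
  shows "(\<Sum>k\<in>F. \<Sum>l\<in>F. A k * A l / (\<bar>real k - real l\<bar> + 1)^2) \<le> 4 * (\<Sum>k\<in>F. (A k)^2)"
proof -
  define h where "h k l = 1 / (\<bar>real k - real l\<bar> + 1)^2" for k l
  have h0: "h k l \<ge> 0" for k l by (simp add: h_def)
  have sym: "h k l = h l k" for k l by (simp add: h_def abs_minus_commute)
  have "A k * A l / (\<bar>real k - real l\<bar> + 1)^2 \<le> ((A k)^2 * h k l + (A l)^2 * h l k) / 2" for k l
  proof -
    have "A k * A l \<le> ((A k)^2 + (A l)^2) / 2" using sum_squares_bound[of "A k" "A l"] by simp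
    from mult_right_mono[OF this h0[of k l]] show ?thesis
      unfolding sym[of l k] by (simp add: h_def field_simps)
  qed
  then have "(\<Sum>k\<in>F. \<Sum>l\<in>F. A k * A l / (\<bar>real k - real l\<bar> + 1)^2)
      \<le> (\<Sum>k\<in>F. \<Sum>l\<in>F. ((A k)^2 * h k l + (A l)^2 * h l k) / 2)"
    by (intro sum_mono)
  also have "\<dots> = ((\<Sum>k\<in>F. \<Sum>l\<in>F. (A k)^2 * h k l) + (\<Sum>k\<in>F. \<Sum>l\<in>F. (A l)^2 * h l k)) / 2"
    by (simp add: sum.distrib flip: sum_divide_distrib)
  also have "(\<Sum>k\<in>F. \<Sum>l\<in>F. (A l)^2 * h l k) = (\<Sum>k\<in>F. \<Sum>l\<in>F. (A k)^2 * h k l)"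
    by (rule sum.swap)
  also have "((\<Sum>k\<in>F. \<Sum>l\<in>F. (A k)^2 * h k l) + (\<Sum>k\<in>F. \<Sum>l\<in>F. (A k)^2 * h k l)) / 2
      = (\<Sum>k\<in>F. (A k)^2 * (\<Sum>l\<in>F. h k l))"
    by (simp only: sum_distrib_left) simp
  also have "\<dots> \<le> (\<Sum>k\<in>F. (A k)^2 * 4)"
    unfolding h_def using assms by (intro sum_mono mult_left_mono sum_inverse_square_distances_le) auto
  finally show ?thesis by (simp add: sum_distrib_left mult.commute)
qed

lemma has_integral_triangle_cos:
  fixes L \<xi> :: real
  assumes "L > 0" "\<xi> \<noteq> 0"
  shows "((\<lambda>y. (1 - y / L) * cos (\<xi> * y)) has_integral (1 - cos (L * \<xi>)) / (L * \<xi>^2)) {0..L}"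
proof -
  \<comment> \<open>The antiderivative obtained from one integration by parts.\<close>
  define G where "G y = (1 - y / L) * sin (\<xi> * y) / \<xi> - cos (\<xi> * y) / (L * \<xi>^2)" for y
  have "(G has_vector_derivative (1 - y / L) * cos (\<xi> * y)) (at y within {0..L})" for y
    unfolding G_def has_real_derivative_iff_has_vector_derivative[symmetric]
    using assms by (auto intro!: derivative_eq_intros simp: field_simps power2_eq_square)
  then have "((\<lambda>y. (1 - y / L) * cos (\<xi> * y)) has_integral (G L - G 0)) {0..L}"
    using assms by (intro fundamental_theorem_of_calculus) auto
  also have "G L - G 0 = (1 - cos (L * \<xi>)) / (L * \<xi>^2)"
    using assms by (simp add: G_def field_simps)
  finally show ?thesis .
qed

text \<open>When the integer parts differ by at most 1, the integral is trivially at most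
  \<open>L\<close>. Otherwise its closed form is at most \<open>2 / (L * (x - y)^2)\<close>, where
  \<open>x - y\<close> is comparable to the distance of the integer parts. Measuring distance by
  integer parts allows the frequencies to be grouped into unit blocks later, with no gap condition
  between them.\<close>

lemma integral_triangle_cos_le:
  fixes L x y :: real
  assumes "L \<ge> 1" "x \<ge> 0" "y \<ge> 0"
  shows "\<bar>integral {0..L} (\<lambda>t. (1 - t / L) * cos ((x - y) * t))\<bar>
    \<le> 18 * L / (\<bar>real (nat \<lfloor>x\<rfloor>) - real (nat \<lfloor>y\<rfloor>)\<bar> + 1)^2"
proof -
  define d where "d = \<bar>real (nat \<lfloor>x\<rfloor>) - real (nat \<lfloor>y\<rfloor>)\<bar>"
  define J where "J = integral {0..L} (\<lambda>t. (1 - t / L) * cos ((x - y) * t))"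
  have d0: "d \<ge> 0" by (simp add: d_def)
  have fl: "real (nat \<lfloor>x\<rfloor>) \<le> x" "x < real (nat \<lfloor>x\<rfloor>) + 1" "real (nat \<lfloor>y\<rfloor>) \<le> y" "y < real (nat \<lfloor>y\<rfloor>) + 1"
    using assms by linarith+
  show ?thesis
  proof (cases "d \<le> 1")
    case True
    have "norm J \<le> integral {0..L} (\<lambda>t. 1)"
      unfolding J_def
    proof (rule integral_norm_bound_integral)
      show "(\<lambda>t. (1 - t / L) * cos ((x - y) * t)) integrable_on {0..L}"
        using assms by (intro integrable_continuous_real continuous_intros) auto
      fix t assume "t \<in> {0..L}"
      then have "\<bar>1 - t / L\<bar> \<le> 1" using assms by (auto simp: abs_le_iff)
      then show "norm ((1 - t / L) * cos ((x - y) * t)) \<le> 1"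
        by (simp add: abs_mult mult_le_one)
    qed auto
    then have 1: "\<bar>J\<bar> \<le> L" using assms by simp
    have "(d + 1)^2 \<le> 2^2" using True d0 by (intro power_mono) auto
    then have "L * (d + 1)^2 \<le> L * 18" using assms by (intro mult_left_mono) auto
    then have "L \<le> 18 * L / (d + 1)^2" using d0 by (simp add: field_simps)
    with 1 show ?thesis unfolding J_def[symmetric] d_def[symmetric] by linarith
  next
    case False
    have nz: "\<bar>x - y\<bar> \<ge> d - 1" "x - y \<noteq> 0" using fl False unfolding d_def by linarith+
    have "J = (1 - cos (L * (x - y))) / (L * (x - y)^2)"
      unfolding J_def using has_integral_triangle_cos[of L "x - y"] assms nz by (intro integral_unique) auto
    moreover have "\<bar>1 - cos (L * (x - y))\<bar> \<le> 2"
      using cos_ge_minus_one[of "L * (x - y)"] cos_le_one[of "L * (x - y)"] by linarith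
    ultimately have "\<bar>J\<bar> \<le> 2 / (L * (x - y)^2)"
      using assms by (simp add: abs_divide abs_mult divide_right_mono)
    also have "\<dots> \<le> 2 / (1 * ((d + 1) / 3)^2)"
    proof -
      \<comment> \<open>As \<open>d\<close> is an integer above 1, it is at least 2, and then
        \<open>d - 1 \<ge> (d + 1) / 3\<close>. This explains the constant 18 as 2 times 9.\<close>
      have d_int: "d = real_of_int \<bar>int (nat \<lfloor>x\<rfloor>) - int (nat \<lfloor>y\<rfloor>)\<bar>" by (simp add: d_def)
      with False have "real_of_int 1 < real_of_int \<bar>int (nat \<lfloor>x\<rfloor>) - int (nat \<lfloor>y\<rfloor>)\<bar>"
        by (simp only: of_int_1 not_le)
      then have "2 \<le> \<bar>int (nat \<lfloor>x\<rfloor>) - int (nat \<lfloor>y\<rfloor>)\<bar>" by (simp only: of_int_less_iff)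
      then have "real_of_int 2 \<le> d" unfolding d_int by (simp only: of_int_le_iff)
      then have "(d + 1) / 3 \<le> \<bar>x - y\<bar>" using nz by simp
      then have "((d + 1) / 3)^2 \<le> \<bar>x - y\<bar>^2" using d0 by (intro power_mono) auto
      then have "1 * ((d + 1) / 3)^2 \<le> L * (x - y)^2" using assms by (intro mult_mono) auto
      then show ?thesis using d0 assms nz by (intro divide_left_mono) auto
    qed
    also have "\<dots> = 18 / (d + 1)^2" by (simp add: power_divide)
    also have "\<dots> \<le> 18 * L / (d + 1)^2" using assms by (intro divide_right_mono) auto
    finally show ?thesis unfolding J_def d_def .
  qed
qed

text \<open>Adding the value at \<open>- y\<close> cancels the sine terms of the expanded square, so
  only the cosine integrals against the triangular weight have to be estimated.\<close>

lemma cmod_square_sum_cis: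
  fixes r :: "'a \<Rightarrow> complex" and lam :: "'a \<Rightarrow> real"
  shows "(cmod (\<Sum>n\<in>N. r n * cis (lam n * y)))^2 + (cmod (\<Sum>n\<in>N. r n * cis (lam n * (- y))))^2
    = (\<Sum>m\<in>N. \<Sum>n\<in>N. 2 * Re (r m * cnj (r n)) * cos ((lam m - lam n) * y))"
proof -
  have sq: "(cmod (\<Sum>n\<in>N. r n * cis (lam n * t)))^2 =
      (\<Sum>m\<in>N. \<Sum>n\<in>N. Re (r m * cnj (r n) * cis ((lam m - lam n) * t)))" for t
  proof -
    have "complex_of_real ((cmod (\<Sum>n\<in>N. r n * cis (lam n * t)))^2) =
        (\<Sum>n\<in>N. r n * cis (lam n * t)) * cnj (\<Sum>n\<in>N. r n * cis (lam n * t))"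
      by (rule complex_norm_square)
    also have "\<dots> = (\<Sum>m\<in>N. \<Sum>n\<in>N. r m * cnj (r n) * cis ((lam m - lam n) * t))"
      unfolding cnj_sum sum_product
      by (intro sum.cong refl) (simp add: cis_mult cis_cnj algebra_simps)
    finally show ?thesis by (metis (mono_tags, lifting) Re_complex_of_real Re_sum sum.cong)
  qed
  show ?thesis unfolding sq sum.distrib[symmetric]
    by (intro sum.cong refl) simp
qed

text \<open>The Fourier transform of the triangular weight is nonnegative and decays quadratically,
  which makes the quadratic form in the coefficients accessible to the Schur test.\<close>

lemma mean_square_trig_sum_le:
  fixes r :: "'a \<Rightarrow> complex" and lam :: "'a \<Rightarrow> real"
  assumes "finite N" "\<And>n. n \<in> N \<Longrightarrow> lam n \<ge> 0" "Y \<ge> 1"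
    "finite F" "\<And>n. n \<in> N \<Longrightarrow> nat \<lfloor>lam n\<rfloor> \<in> F"
  shows "integral {0..Y} (\<lambda>y. (cmod (\<Sum>n\<in>N. r n * cis (lam n * y)))^2)
    \<le> 600 * Y * (\<Sum>k\<in>F. (\<Sum>n | n \<in> N \<and> nat \<lfloor>lam n\<rfloor> = k. norm (r n))^2)"
proof -
  \<comment> \<open>Twice the length, so that the weight \<open>1 - y / L\<close> is at least 1/2 on
    \<open>[0, Y]\<close>.\<close>
  define L where "L = 2 * Y"
  define Q where "Q y = (cmod (\<Sum>n\<in>N. r n * cis (lam n * y)))^2" for y
  define A where "A k = (\<Sum>n | n \<in> N \<and> nat \<lfloor>lam n\<rfloor> = k. norm (r n))" for k
  define fl where "fl n = nat \<lfloor>lam n\<rfloor>" for n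
  have contQ: "continuous_on S Q" for S
    unfolding Q_def by (intro continuous_intros)
  have contQ': "continuous_on S (\<lambda>y. Q (- y))" for S
    by (intro continuous_on_compose2[OF contQ[of UNIV]] continuous_intros) auto
  have L: "L \<ge> 1" using assms by (simp add: L_def)
  \<comment> \<open>The reflected term \<open>Q (- y)\<close> is nonnegative, so including it only
    enlarges the integral.\<close>
  define g where "g y = (1 - y / L) * (Q y + Q (- y))" for y
  define J where "J m n = integral {0..L} (\<lambda>y. (1 - y / L) * cos ((lam m - lam n) * y))" for m n
  have intg: "g integrable_on {0..b}" for b
    unfolding g_def using L by (auto intro!: integrable_continuous_real continuous_intros contQ contQ')
  have "integral {0..Y} (\<lambda>y. 1 / 2 * Q y) \<le> integral {0..Y} g"
  proof (rule integral_le)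
    fix y assume "y \<in> {0..Y}"
    then have "1 / 2 \<le> 1 - y / L" using assms by (simp add: L_def field_simps)
    moreover from this have "0 \<le> 1 - y / L" by linarith
    ultimately show "1 / 2 * Q y \<le> g y" unfolding g_def
      by (intro mult_mono) (insert L, simp_all only: Q_def, simp_all)
  qed (auto intro!: intg integrable_continuous_real continuous_intros contQ)
  also have "\<dots> \<le> integral {0..L} g"
  proof (intro integral_subset_le ballI)
    show "{0..Y} \<subseteq> {0..L}" using assms(3) by (auto simp: L_def)
    fix y assume "y \<in> {0..L}"
    then have "0 \<le> 1 - y / L" using L by (simp add: field_simps)
    then show "0 \<le> g y" by (auto simp: g_def Q_def)
  qed (auto intro!: intg integrable_continuous_real continuous_intros contQ)
  also have "integral {0..L} g = (\<Sum>m\<in>N. \<Sum>n\<in>N. 2 * Re (r m * cnj (r n)) * J m n)"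
  proof (rule integral_unique)
    have "((\<lambda>y. (1 - y / L) * cos ((lam m - lam n) * y)) has_integral J m n) {0..L}" for m n
      unfolding J_def using L
      by (intro integrable_integral integrable_continuous_real continuous_intros) auto
    then have "((\<lambda>y. \<Sum>m\<in>N. \<Sum>n\<in>N. 2 * Re (r m * cnj (r n)) * ((1 - y / L) * cos ((lam m - lam n) * y)))
        has_integral (\<Sum>m\<in>N. \<Sum>n\<in>N. 2 * Re (r m * cnj (r n)) * J m n)) {0..L}"
      using assms(1) by (intro has_integral_sum has_integral_mult_right) auto
    moreover have "g y = (\<Sum>m\<in>N. \<Sum>n\<in>N. 2 * Re (r m * cnj (r n)) * ((1 - y / L) * cos ((lam m - lam n) * y)))" for y
    proof -
      have "g y = (1 - y / L) * (\<Sum>m\<in>N. \<Sum>n\<in>N. 2 * Re (r m * cnj (r n)) * cos ((lam m - lam n) * y))"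
        unfolding g_def Q_def by (subst cmod_square_sum_cis) (rule refl)
      also have "\<dots> = (\<Sum>m\<in>N. \<Sum>n\<in>N. (1 - y / L) * (2 * Re (r m * cnj (r n)) * cos ((lam m - lam n) * y)))"
        by (simp only: sum_distrib_left)
      also have "\<dots> = (\<Sum>m\<in>N. \<Sum>n\<in>N. 2 * Re (r m * cnj (r n)) * ((1 - y / L) * cos ((lam m - lam n) * y)))"
        by (intro sum.cong refl mult.left_commute)
      finally show ?thesis .
    qed
    ultimately show "(g has_integral (\<Sum>m\<in>N. \<Sum>n\<in>N. 2 * Re (r m * cnj (r n)) * J m n)) {0..L}"
      by (subst has_integral_cong)
  qed
  also have "\<dots> \<le> (\<Sum>m\<in>N. \<Sum>n\<in>N. 2 * (norm (r m) * norm (r n)) *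
      (18 * L / (\<bar>real (fl m) - real (fl n)\<bar> + 1)^2))"
  proof (intro sum_mono)
    fix m n assume mn: "m \<in> N" "n \<in> N"
    have "2 * Re (r m * cnj (r n)) * J m n \<le> \<bar>2 * Re (r m * cnj (r n))\<bar> * \<bar>J m n\<bar>"
      by (metis abs_ge_self abs_mult)
    also have "\<dots> \<le> (2 * (norm (r m) * norm (r n))) * (18 * L / (\<bar>real (fl m) - real (fl n)\<bar> + 1)^2)"
    proof (rule mult_mono)
      show "\<bar>2 * Re (r m * cnj (r n))\<bar> \<le> 2 * (norm (r m) * norm (r n))"
        using abs_Re_le_cmod[of "r m * cnj (r n)"] by (simp add: norm_mult abs_mult)
        show "\<bar>J m n\<bar> \<le> 18 * L / (\<bar>real (fl m) - real (fl n)\<bar> + 1)^2"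
        unfolding J_def fl_def using mn assms(2) L by (intro integral_triangle_cos_le) auto
    qed auto
    finally show "2 * Re (r m * cnj (r n)) * J m n \<le>
      2 * (norm (r m) * norm (r n)) * (18 * L / (\<bar>real (fl m) - real (fl n)\<bar> + 1)^2)" .
  qed
  also have "\<dots> = 36 * L * (\<Sum>m\<in>N. \<Sum>n\<in>N. norm (r m) * norm (r n) / (\<bar>real (fl m) - real (fl n)\<bar> + 1)^2)"
    unfolding sum_distrib_left by (intro sum.cong refl) (simp)
  also have "\<dots> \<le> 36 * L * (4 * (\<Sum>k\<in>F. (A k)^2))"
  proof (intro mult_left_mono)
    \<comment> \<open>Grouping the frequencies by integer part turns the double sum into the
      quadratic form of the Schur test in the block masses \<open>A k\<close>.\<close>
    have group: "sum h N = (\<Sum>k\<in>F. \<Sum>n | n \<in> N \<and> fl n = k. h n)" for h :: "'a \<Rightarrow> real"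
      using assms by (intro sum.group[symmetric]) (auto simp: fl_def)
    have "(\<Sum>m\<in>N. \<Sum>n\<in>N. norm (r m) * norm (r n) / (\<bar>real (fl m) - real (fl n)\<bar> + 1)^2)
      = (\<Sum>k\<in>F. \<Sum>m | m \<in> N \<and> fl m = k. \<Sum>l\<in>F. \<Sum>n | n \<in> N \<and> fl n = l.
           norm (r m) * norm (r n) / (\<bar>real (fl m) - real (fl n)\<bar> + 1)^2)"
      unfolding group[of "\<lambda>n. norm (r m) * norm (r n) / (\<bar>real (fl m) - real (fl n)\<bar> + 1)^2" for m]
      by (rule group)
    also have "\<dots> = (\<Sum>k\<in>F. \<Sum>l\<in>F. \<Sum>m | m \<in> N \<and> fl m = k. \<Sum>n | n \<in> N \<and> fl n = l.
           norm (r m) * norm (r n) / (\<bar>real (fl m) - real (fl n)\<bar> + 1)^2)"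
      by (intro sum.cong refl sum.swap)
    also have "\<dots> = (\<Sum>k\<in>F. \<Sum>l\<in>F. A k * A l / (\<bar>real k - real l\<bar> + 1)^2)"
      unfolding A_def fl_def[symmetric] sum_product sum_divide_distrib
      by (intro sum.cong refl) auto
    also have "\<dots> \<le> 4 * (\<Sum>k\<in>F. (A k)^2)"
      using assms by (intro schur_inverse_square_distances)
    finally show "(\<Sum>m\<in>N. \<Sum>n\<in>N. norm (r m) * norm (r n) / (\<bar>real (fl m) - real (fl n)\<bar> + 1)^2)
      \<le> 4 * (\<Sum>k\<in>F. (A k)^2)" .
  qed (use L in auto)
  finally have "integral {0..Y} Q \<le> 2 * (36 * L * (4 * (\<Sum>k\<in>F. (A k)^2)))" by simp
  also have "\<dots> \<le> 600 * Y * (\<Sum>k\<in>F. (A k)^2)"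
  proof -
    \<comment> \<open>With \<open>L = 2 * Y\<close> the accumulated factor is
      \<open>576 * Y\<close>, rounded up to \<open>600 * Y\<close>.\<close>
    have "288 * Y * (\<Sum>k\<in>F. (A k)^2) \<le> 600 * Y * (\<Sum>k\<in>F. (A k)^2)"
      using assms(3) by (intro mult_right_mono sum_nonneg) auto
    then show ?thesis by (simp add: L_def)
  qed
  finally show ?thesis unfolding Q_def A_def .
qed

section \<open>Sums of coefficients\<close>

text \<open>Bounding the sum over \<open>[T, T + 1]\<close> for every real \<open>T \<ge> T0\<close> only enters through integer blocks,
  and enlarging the constant removes the threshold; the shift by \<open>1\<close> keeps the base positive.\<close>

lemma block_bound:
  fixes lam :: "nat \<Rightarrow> real" and r :: "nat \<Rightarrow> complex"
  assumes pos: "\<And>n. lam n > 0" and fin: "\<And>X. finite {n. lam n \<le> X}" and "\<beta> > 0" and "C > 0" "T0 > 0"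
    and bd: "\<And>T. T \<ge> T0 \<Longrightarrow> (\<Sum>n | T \<le> lam n \<and> lam n \<le> T + 1. norm (r n)) \<le> C * T powr (- \<beta>)"
  obtains K where "K > 0"
    "\<And>k. (\<Sum>n | nat \<lfloor>lam n\<rfloor> = k. norm (r n)) \<le> K * (real k + 1) powr (- \<beta>)"
proof
  define S where "S k = (\<Sum>n | nat \<lfloor>lam n\<rfloor> = k. norm (r n))" for k
  define N0 where "N0 = nat \<lceil>T0\<rceil>"
  \<comment> \<open>The first summand serves the blocks beyond the threshold, the second the
    finitely many blocks below it.\<close>
  define K where "K = C * 2 powr \<beta> + (\<Sum>k<N0. S k * (real k + 1) powr \<beta>)"
  have S0: "S k \<ge> 0" for k by (auto simp: S_def intro: sum_nonneg)
  show "K > 0" unfolding K_def using S0 assms(4)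
    by (intro add_pos_nonneg sum_nonneg mult_pos_pos mult_nonneg_nonneg) auto
  fix k
  show "(\<Sum>n | nat \<lfloor>lam n\<rfloor> = k. norm (r n)) \<le> K * (real k + 1) powr (- \<beta>)"
  proof (cases "k < N0")
    case True
    then have "S k * (real k + 1) powr \<beta> \<le> (\<Sum>k<N0. S k * (real k + 1) powr \<beta>)"
      by (intro member_le_sum) (auto simp: S0)
    also have "\<dots> \<le> K" using assms(4) by (simp add: K_def)
    finally show ?thesis by (simp add: S_def powr_minus field_simps)
  next
    case False
    then have k: "real k \<ge> T0" "real k > 0" unfolding N0_def using \<open>T0 > 0\<close> by linarith+
    have "finite {n. real k \<le> lam n \<and> lam n \<le> real k + 1}"
      by (rule finite_subset[OF _ fin[of "real k + 1"]]) auto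
    moreover have "real (nat \<lfloor>lam n\<rfloor>) \<le> lam n \<and> lam n \<le> real (nat \<lfloor>lam n\<rfloor>) + 1" for n
      using pos[of n] by linarith
    ultimately have "S k \<le> (\<Sum>n | real k \<le> lam n \<and> lam n \<le> real k + 1. norm (r n))"
      unfolding S_def by (intro sum_mono2) auto
    also have "\<dots> \<le> C * real k powr (- \<beta>)" using bd k by simp
    \<comment> \<open>Here \<open>k \<ge> 1\<close>, hence \<open>k \<ge> (k + 1) / 2\<close>; this
      costs the factor \<open>2 powr \<beta>\<close> in \<open>K\<close>.\<close>
    also have "real k powr (- \<beta>) \<le> ((real k + 1) / 2) powr (- \<beta>)"
      using k False \<open>\<beta> > 0\<close> by (intro powr_mono2') auto
    also have "\<dots> = 2 powr \<beta> * (real k + 1) powr (- \<beta>)"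
      by (simp add: powr_divide powr_minus divide_simps)
    finally have "S k \<le> C * 2 powr \<beta> * (real k + 1) powr (- \<beta>)" using assms(4) by simp
    also have "\<dots> \<le> K * (real k + 1) powr (- \<beta>)"
      unfolding K_def by (intro mult_right_mono) (auto intro!: sum_nonneg mult_nonneg_nonneg S0)
    finally show ?thesis by (simp add: S_def)
  qed
qed

text \<open>Mean value theorem for \<open>t powr (1 - s) / (1 - s)\<close>, whose derivative
  \<open>t powr (- s)\<close> decreases. At \<open>x = 0\<close> the power may fail to be
  differentiable and the inequality is checked directly. For \<open>s > 1\<close> the convention
  \<open>0 powr a = 0\<close> would make it false there, whence the last hypothesis.\<close>

lemma powr_le_diff_powr:
  fixes s x :: real
  assumes "x \<ge> 0" "s > 0" "s \<noteq> 1" "x > 0 \<or> s < 1"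
  shows "(x + 1) powr (- s) \<le> ((x + 1) powr (1 - s) - x powr (1 - s)) / (1 - s)"
proof (cases "x = 0")
  case True
  then show ?thesis using assms by (simp add: field_simps)
next
  case False
  with assms have x: "x > 0" by simp
  define f where "f t = t powr (1 - s) / (1 - s)" for t :: real
  have "(f has_real_derivative t powr (- s)) (at t)" if "x \<le> t" for t
  proof -
    have "((\<lambda>t. t powr (1 - s)) has_real_derivative (1 - s) * t powr (1 - s - 1)) (at t)"
      using that x by (intro has_real_derivative_powr) auto
    from DERIV_cdivide[OF this, of "1 - s"] show ?thesis using assms(3) unfolding f_def by simp
  qed
  then obtain z where z: "x < z" "z < x + 1" "f (x + 1) - f x = (x + 1 - x) * z powr (- s)"
    using MVT2[of x "x + 1" f "\<lambda>t. t powr (- s)"] by auto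
  have "(x + 1) powr (- s) \<le> z powr (- s)" using z x assms by (intro powr_mono2') auto
  with z show ?thesis by (simp add: f_def diff_divide_distrib)
qed

text \<open>The integral comparison telescopes, and the boundary term at \<open>M\<close> has the
  favourable sign, so the bound is uniform in \<open>M\<close>.\<close>

lemma sum_powr_tail_le:
  fixes s :: real
  assumes "s > 1" "m \<ge> 1"
  shows "(\<Sum>k=m..<M. (real k + 1) powr (- s)) \<le> real m powr (1 - s) / (s - 1)"
proof (cases "m \<le> M")
  case True
  have "(\<Sum>k=m..<M. (real k + 1) powr (- s)) \<le>
      (\<Sum>k=m..<M. real (Suc k) powr (1 - s) / (1 - s) - real k powr (1 - s) / (1 - s))"
    using assms powr_le_diff_powr[of "real k" s for k]
    by (intro sum_mono) (auto simp: diff_divide_distrib add.commute)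
  also have "\<dots> = real M powr (1 - s) / (1 - s) - real m powr (1 - s) / (1 - s)"
    using True by (rule sum_Suc_diff')
  also have "\<dots> = real m powr (1 - s) / (s - 1) - real M powr (1 - s) / (s - 1)"
    using assms by (simp add: field_simps)
  finally show ?thesis using assms by (smt (verit) divide_nonneg_pos powr_ge_zero)
qed (use assms in simp)

text \<open>The same telescoping started at 0, where \<open>0 powr (1 - s) = 0\<close> removes the
  lower boundary term.\<close>

lemma sum_powr_le:
  fixes s :: real
  assumes "0 < s" "s < 1"
  shows "(\<Sum>k<M. (real k + 1) powr (- s)) \<le> real M powr (1 - s) / (1 - s)"
proof -
  have "(\<Sum>k<M. (real k + 1) powr (- s)) \<le>
      (\<Sum>k<M. real (Suc k) powr (1 - s) / (1 - s) - real k powr (1 - s) / (1 - s))"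
    using assms powr_le_diff_powr[of "real k" s for k]
    by (intro sum_mono) (auto simp: diff_divide_distrib add.commute)
  also have "\<dots> = real M powr (1 - s) / (1 - s) - real 0 powr (1 - s) / (1 - s)"
    by (rule sum_lessThan_telescope)
  finally show ?thesis by simp
qed

text \<open>Applying \<open>ln x \<le> x - 1\<close> to \<open>n / (n + 1)\<close> shows that each
  new term \<open>1 / (n + 1)\<close> is at most the increment of the logarithm.\<close>

lemma harm_le_ln:
  assumes "n \<ge> 1"
  shows "harm n \<le> 1 + ln (real n)"
  using assms
proof (induction n rule: dec_induct)
  case base
  then show ?case by (simp add: harm_expand)
next
  case (step n)
  have "ln (real n / real (Suc n)) \<le> real n / real (Suc n) - 1"
    using step by (intro ln_le_minus_one) auto
  also have "ln (real n / real (Suc n)) = ln (real n) - ln (real (Suc n))"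
    using step by (simp add: ln_div)
  also have "real n / real (Suc n) - 1 = - inverse (real (Suc n))"
    by (simp add: field_simps)
  finally show ?case using step unfolding harm_Suc by simp
qed

lemma sum_coeffs_le_blocks:
  fixes lam :: "nat \<Rightarrow> real" and r :: "nat \<Rightarrow> complex"
  assumes "\<And>n. lam n > 0" and fin: "\<And>X. finite {n. lam n \<le> X}"
    and bd: "\<And>k. (\<Sum>n | nat \<lfloor>lam n\<rfloor> = k. norm (r n)) \<le> K * (real k + 1) powr (- \<beta>)"
  shows "(\<Sum>n | lam n \<le> T. norm (r n)) \<le> K * (\<Sum>k<nat \<lfloor>T\<rfloor> + 1. (real k + 1) powr (- \<beta>))"
proof -
  have finb: "finite {n. nat \<lfloor>lam n\<rfloor> = k}" for k
    by (rule finite_subset[OF _ fin[of "real k + 1"]]) (auto, linarith)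
  have "(\<Sum>n | lam n \<le> T. norm (r n)) =
      (\<Sum>k<nat \<lfloor>T\<rfloor> + 1. \<Sum>n | n \<in> {n. lam n \<le> T} \<and> nat \<lfloor>lam n\<rfloor> = k. norm (r n))"
    using fin[of T] by (intro sum.group[symmetric]) (auto simp: less_Suc_eq_le intro!: nat_mono floor_mono)
  also have "\<dots> \<le> (\<Sum>k<nat \<lfloor>T\<rfloor> + 1. \<Sum>n | nat \<lfloor>lam n\<rfloor> = k. norm (r n))"
    by (intro sum_mono sum_mono2 finb) auto
  also have "\<dots> \<le> (\<Sum>k<nat \<lfloor>T\<rfloor> + 1. K * (real k + 1) powr (- \<beta>))"
    by (intro sum_mono bd)
  finally show ?thesis by (simp only: sum_distrib_left)
qed

text \<open>Twice this coefficient mass bounds the partial sum up to \<open>T\<close> uniformly in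
  \<open>y\<close>. Its three growth rates are what separates the three tail estimates for the
  limiting distribution.\<close>

lemma sum_coeffs_le:
  fixes lam :: "nat \<Rightarrow> real" and r :: "nat \<Rightarrow> complex"
  assumes "\<And>n. lam n > 0" and "\<And>X. finite {n. lam n \<le> X}" and K: "K > 0"
    and "\<And>k. (\<Sum>n | nat \<lfloor>lam n\<rfloor> = k. norm (r n)) \<le> K * (real k + 1) powr (- \<beta>)" and T: "T \<ge> 1"
  shows "0 < \<beta> \<Longrightarrow> \<beta> < 1 \<Longrightarrow> (\<Sum>n | lam n \<le> T. norm (r n)) \<le> 2 * K / (1 - \<beta>) * T powr (1 - \<beta>)"
    and "\<beta> = 1 \<Longrightarrow> (\<Sum>n | lam n \<le> T. norm (r n)) \<le> 2 * K * (1 + ln T)"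
    and "\<beta> > 1 \<Longrightarrow> (\<Sum>n | lam n \<le> T. norm (r n)) \<le> K * (1 + 1 / (\<beta> - 1))"
proof -
  \<comment> \<open>The number of blocks meeting \<open>[0, T]\<close>, counting the one that
    contains \<open>T\<close>; it is at most \<open>2 * T\<close> because
    \<open>T \<ge> 1\<close>.\<close>
  define M where "M = nat \<lfloor>T\<rfloor> + 1"
  have M: "real M \<le> 2 * T" "M \<ge> 1" using T unfolding M_def by linarith+
  have le: "(\<Sum>n | lam n \<le> T. norm (r n)) \<le> K * (\<Sum>k<M. (real k + 1) powr (- \<beta>))"
    unfolding M_def by (rule sum_coeffs_le_blocks) (use assms in auto)
  {
    assume b: "0 < \<beta>" "\<beta> < 1"
    have "real M powr (1 - \<beta>) \<le> (2 * T) powr (1 - \<beta>)" using M b by (intro powr_mono2) auto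
    also have "\<dots> = 2 powr (1 - \<beta>) * T powr (1 - \<beta>)" using T by (simp add: powr_mult)
    also have "\<dots> \<le> 2 powr 1 * T powr (1 - \<beta>)" using b by (intro mult_right_mono powr_mono) auto
    finally have "real M powr (1 - \<beta>) \<le> 2 * T powr (1 - \<beta>)" by simp
    then have "(\<Sum>k<M. (real k + 1) powr (- \<beta>)) \<le> 2 * T powr (1 - \<beta>) / (1 - \<beta>)"
      using sum_powr_le[OF b, of M] b by (smt (verit) divide_right_mono)
    from order_trans[OF le mult_left_mono[OF this less_imp_le[OF K]]]
    show "(\<Sum>n | lam n \<le> T. norm (r n)) \<le> 2 * K / (1 - \<beta>) * T powr (1 - \<beta>)" by (simp add: field_simps)
  }
  {
    assume b: "\<beta> = 1"
    have "(\<Sum>k<M. (real k + 1) powr (- \<beta>)) = harm M"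
      unfolding harm_def b by (rule sum.reindex_bij_witness[of _ "\<lambda>k. k - 1" Suc])
        (auto simp: powr_minus add.commute)
    also have "\<dots> \<le> 1 + ln (real M)" using harm_le_ln[of M] M by simp
    also have "ln (real M) \<le> ln (2 * T)" using M T by (subst ln_le_cancel_iff) auto
    also have "\<dots> = ln 2 + ln T" using T by (simp add: ln_mult)
    also have "1 + (ln 2 + ln T) \<le> 2 * (1 + ln T)" using ln_le_minus_one[of "2::real"] ln_ge_zero[OF T] by simp
    finally have "(\<Sum>k<M. (real k + 1) powr (- \<beta>)) \<le> 2 * (1 + ln T)" by simp
    from order_trans[OF le mult_left_mono[OF this less_imp_le[OF K]]]
    show "(\<Sum>n | lam n \<le> T. norm (r n)) \<le> 2 * K * (1 + ln T)" by (simp add: algebra_simps)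
  }
  {
    assume b: "\<beta> > 1"
    \<comment> \<open>The term \<open>k = 0\<close> is split off because the integral comparison for
      \<open>\<beta> > 1\<close> has to start at a positive integer.\<close>
    have "(\<Sum>k<M. (real k + 1) powr (- \<beta>)) = 1 + (\<Sum>k=1..<M. (real k + 1) powr (- \<beta>))"
      using M sum.atLeast_Suc_lessThan[of 0 M "\<lambda>k. (real k + 1) powr (- \<beta>)"] by (simp add: atLeast0LessThan)
    also have "\<dots> \<le> 1 + 1 / (\<beta> - 1)" using sum_powr_tail_le[of \<beta> 1 M] b by simp
    finally have "(\<Sum>k<M. (real k + 1) powr (- \<beta>)) \<le> 1 + 1 / (\<beta> - 1)" .
    from order_trans[OF le mult_left_mono[OF this less_imp_le[OF K]]]
    show "(\<Sum>n | lam n \<le> T. norm (r n)) \<le> K * (1 + 1 / (\<beta> - 1))" by simp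
  }
qed

text \<open>The mean square inequality is applied to the frequencies in \<open>(T, X]\<close>. Their
  squared block masses are dominated by \<open>K^2 * (k + 1) powr (- 2 * \<beta>)\<close>, which is
  summable since \<open>\<beta> > 1 / 2\<close>. The bound does not depend on \<open>X\<close>, so
  the cutoff may later vary with \<open>Y\<close>.\<close>

lemma mean_square_tail_le:
  fixes lam :: "nat \<Rightarrow> real" and r :: "nat \<Rightarrow> complex"
  assumes pos: "\<And>n. lam n > 0" and fin: "\<And>X. finite {n. lam n \<le> X}" and K: "K > 0" and \<beta>: "\<beta> > 1 / 2"
    and bd: "\<And>k. (\<Sum>n | nat \<lfloor>lam n\<rfloor> = k. norm (r n)) \<le> K * (real k + 1) powr (- \<beta>)"
    and T: "T \<ge> 1" and Y: "Y \<ge> 1"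
  shows "integral {0..Y} (\<lambda>y. (cmod (\<Sum>n | T < lam n \<and> lam n \<le> X. r n * cis (lam n * y)))^2)
    \<le> 600 * Y * (K^2 * (T powr (1 - 2 * \<beta>) * 2 powr (2 * \<beta> - 1) / (2 * \<beta> - 1)))"
proof -
  define N where "N = {n. T < lam n \<and> lam n \<le> X}"
  define m where "m = nat \<lfloor>T\<rfloor>"
  define F where "F = {m..<nat \<lfloor>X\<rfloor> + 1}"
  have m1: "m \<ge> 1" using T unfolding m_def by linarith
  \<comment> \<open>The integer part of \<open>T \<ge> 1\<close> is at least \<open>T / 2\<close>;
    the factor \<open>2 powr (2 * \<beta> - 1)\<close> comes from here.\<close>
  have "T < real m + 1" unfolding m_def using T by linarith
  with m1 have m: "m \<ge> 1" "T / 2 \<le> real m" by linarith+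
  have finb: "finite {n. nat \<lfloor>lam n\<rfloor> = k}" for k
    by (rule finite_subset[OF _ fin[of "real k + 1"]]) (auto, linarith)
  have finN: "finite N" unfolding N_def by (rule finite_subset[OF _ fin[of X]]) auto
  have "integral {0..Y} (\<lambda>y. (cmod (\<Sum>n\<in>N. r n * cis (lam n * y)))^2)
      \<le> 600 * Y * (\<Sum>k\<in>F. (\<Sum>n | n \<in> N \<and> nat \<lfloor>lam n\<rfloor> = k. norm (r n))^2)"
  proof (rule mean_square_trig_sum_le)
    fix n assume "n \<in> N"
    then have "m \<le> nat \<lfloor>lam n\<rfloor>" "nat \<lfloor>lam n\<rfloor> \<le> nat \<lfloor>X\<rfloor>"
      unfolding N_def m_def by (auto intro!: nat_mono floor_mono)
    then show "nat \<lfloor>lam n\<rfloor> \<in> F" unfolding F_def by simp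
    show "0 \<le> lam n" using pos[of n] by simp
  qed (simp_all add: finN Y F_def)
  also have "\<dots> \<le> 600 * Y * (K^2 * (T powr (1 - 2 * \<beta>) * 2 powr (2 * \<beta> - 1) / (2 * \<beta> - 1)))"
  proof (intro mult_left_mono)
    have "(\<Sum>k\<in>F. (\<Sum>n | n \<in> N \<and> nat \<lfloor>lam n\<rfloor> = k. norm (r n))^2)
        \<le> (\<Sum>k\<in>F. (K * (real k + 1) powr (- \<beta>))^2)"
    proof (intro sum_mono power_mono sum_nonneg)
      fix k
      have "(\<Sum>n | n \<in> N \<and> nat \<lfloor>lam n\<rfloor> = k. norm (r n)) \<le> (\<Sum>n | nat \<lfloor>lam n\<rfloor> = k. norm (r n))"
        by (intro sum_mono2 finb) auto
      with bd[of k] show "(\<Sum>n | n \<in> N \<and> nat \<lfloor>lam n\<rfloor> = k. norm (r n)) \<le> K * (real k + 1) powr (- \<beta>)"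
        by linarith
    qed auto
    also have "\<dots> = K^2 * (\<Sum>k\<in>F. (real k + 1) powr (- (2 * \<beta>)))"
      unfolding sum_distrib_left
    proof (intro sum.cong refl)
      fix k
      have "((real k + 1) powr (- \<beta>))^2 = (real k + 1) powr (- (2 * \<beta>))"
        unfolding power2_eq_square by (subst powr_add[symmetric]) simp
      then show "(K * (real k + 1) powr (- \<beta>))^2 = K^2 * (real k + 1) powr (- (2 * \<beta>))"
        by (simp only: power_mult_distrib)
    qed
    also have "\<dots> \<le> K^2 * (real m powr (1 - 2 * \<beta>) / (2 * \<beta> - 1))"
      unfolding F_def using \<beta> m by (intro mult_left_mono sum_powr_tail_le) auto
    also have "\<dots> \<le> K^2 * (T powr (1 - 2 * \<beta>) * 2 powr (2 * \<beta> - 1) / (2 * \<beta> - 1))"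
    proof (intro mult_left_mono divide_right_mono)
      have "real m powr (1 - 2 * \<beta>) \<le> (T / 2) powr (1 - 2 * \<beta>)"
        using m T \<beta> by (intro powr_mono2') simp_all
      also have "\<dots> = T powr (1 - 2 * \<beta>) / 2 powr (- (2 * \<beta> - 1))"
        using T by (simp only: powr_divide minus_diff_eq)
      also have "\<dots> = T powr (1 - 2 * \<beta>) * 2 powr (2 * \<beta> - 1)"
        by (simp only: powr_minus divide_inverse inverse_inverse_eq)
      finally show "real m powr (1 - 2 * \<beta>) \<le> T powr (1 - 2 * \<beta>) * 2 powr (2 * \<beta> - 1)" .
    qed (use \<beta> in auto)
    finally show "(\<Sum>k\<in>F. (\<Sum>n | n \<in> N \<and> nat \<lfloor>lam n\<rfloor> = k. norm (r n))^2)
        \<le> K^2 * (T powr (1 - 2 * \<beta>) * 2 powr (2 * \<beta> - 1) / (2 * \<beta> - 1))" .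
  qed (use Y in auto)
  finally show ?thesis unfolding N_def .
qed

section \<open>Means of exponentials of trigonometric polynomials\<close>

text \<open>Cauchy criterion: values eventually within \<open>e / 3\<close> of a common point are
  within \<open>e\<close> of each other. The point \<open>L\<close> may change with
  \<open>e\<close>, as it does when a function is replaced by better and better
  approximations.\<close>

lemma convergent_if_approximable:
  fixes f :: "'a \<Rightarrow> 'b::complete_space"
  assumes "F \<noteq> bot" and approx: "\<And>e. e > 0 \<Longrightarrow> \<exists>L. eventually (\<lambda>x. dist (f x) L \<le> e) F"
  shows "\<exists>L. (f \<longlongrightarrow> L) F"
proof -
  have "cauchy_filter (filtermap f F)"
    unfolding cauchy_filter_metric_filtermap
  proof (intro allI impI)
    fix e :: real assume "e > 0"
    with approx[of "e / 3"] obtain L where "eventually (\<lambda>x. dist (f x) L \<le> e / 3) F" by auto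
    moreover have "dist (f x) (f y) < e" if "dist (f x) L \<le> e / 3" "dist (f y) L \<le> e / 3" for x y
      using dist_triangle2[of "f x" "f y" L] that \<open>e > 0\<close> by simp
    ultimately show "\<exists>P. eventually P F \<and> (\<forall>x y. P x \<and> P y \<longrightarrow> dist (f x) (f y) < e)"
      by blast
  qed
  moreover have "filtermap f F \<noteq> bot" using assms(1) by (simp add: filtermap_bot_iff)
  ultimately obtain L where "filtermap f F \<le> nhds L"
    using cauchy_filter_complete_converges[OF _ complete_UNIV, of "filtermap f F"] by auto
  then show ?thesis unfolding filterlim_def by auto
qed

text \<open>Requiring the means of all twists by \<open>cis (\<xi> y)\<close> makes the class stable under multiplication by
  trigonometric polynomials.\<close>

definition has_means :: "(real \<Rightarrow> complex) \<Rightarrow> bool" where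
  "has_means f \<longleftrightarrow> continuous_on UNIV f \<and>
     (\<forall>\<xi>. \<exists>L. ((\<lambda>Y. (1 / Y) *\<^sub>R integral {0..Y} (\<lambda>y. f y * cis (\<xi> * y))) \<longlongrightarrow> L) at_top)"

text \<open>For \<open>\<xi> \<noteq> 0\<close> the integral of \<open>cis (\<xi> * y)\<close> stays
  bounded by \<open>2 / \<bar>\<xi>\<bar>\<close>, so the mean tends to 0; for
  \<open>\<xi> = 0\<close> it is 1.\<close>

lemma has_means_one: "has_means (\<lambda>y. 1)"
  unfolding has_means_def
proof (intro conjI allI)
  fix \<xi> :: real
  show "\<exists>L. ((\<lambda>Y. (1 / Y) *\<^sub>R integral {0..Y} (\<lambda>y. 1 * cis (\<xi> * y))) \<longlongrightarrow> L) at_top"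
  proof (cases "\<xi> = 0")
    case True
    have "eventually (\<lambda>Y. (1 / Y) *\<^sub>R integral {0..Y} (\<lambda>y. 1 * cis (\<xi> * y)) = 1) at_top"
      using eventually_gt_at_top[of "0::real"] by eventually_elim (simp add: True scaleR_conv_of_real)
    then show ?thesis by (intro exI[of _ 1] tendsto_eventually)
  next
    case False
    have eq: "integral {0..Y} (\<lambda>y. 1 * cis (\<xi> * y)) = (cis (\<xi> * Y) - 1) / (\<i> * \<xi>)" if "Y > 0" for Y
    proof -
      have "((\<lambda>y. cis (\<xi> * y) / (\<i> * \<xi>)) has_vector_derivative cis (\<xi> * y)) (at y within {0..Y})" for y
      proof -
        have "((\<lambda>z. exp (\<i> * \<xi> * z) / (\<i> * \<xi>)) has_field_derivative exp (\<i> * \<xi> * of_real y)) (at (of_real y))"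
          using False by (auto intro!: derivative_eq_intros)
        from has_vector_derivative_real_field[OF this] show ?thesis
          by (simp add: cis_conv_exp mult.assoc)
      qed
      then have "((\<lambda>y. cis (\<xi> * y)) has_integral cis (\<xi> * Y) / (\<i> * \<xi>) - cis (\<xi> * 0) / (\<i> * \<xi>)) {0..Y}"
        using that by (intro fundamental_theorem_of_calculus) auto
      then show ?thesis by (simp add: integral_unique diff_divide_distrib)
    qed
    have "((\<lambda>Y. (1 / Y) *\<^sub>R integral {0..Y} (\<lambda>y. 1 * cis (\<xi> * y))) \<longlongrightarrow> 0) at_top"
    proof (rule Lim_null_comparison)
      show "((\<lambda>Y. 2 / \<bar>\<xi>\<bar> * (1 / Y)) \<longlongrightarrow> 0) at_top"
        by (intro tendsto_mult_right_zero tendsto_divide_0[OF tendsto_const] filterlim_at_top_imp_at_infinity filterlim_ident)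
      show "eventually (\<lambda>Y. norm ((1 / Y) *\<^sub>R integral {0..Y} (\<lambda>y. 1 * cis (\<xi> * y))) \<le> 2 / \<bar>\<xi>\<bar> * (1 / Y)) at_top"
        using eventually_gt_at_top[of "0::real"]
      proof eventually_elim
        case (elim Y)
        have "norm (cis (\<xi> * Y) - 1) \<le> 2" using norm_triangle_ineq4[of "cis (\<xi> * Y)" 1] by simp
        then have "norm (integral {0..Y} (\<lambda>y. 1 * cis (\<xi> * y))) \<le> 2 / \<bar>\<xi>\<bar>"
          unfolding eq[OF elim] by (simp add: norm_divide norm_mult divide_right_mono)
        then show ?case using elim by (simp add: field_simps)
      qed
    qed
    then show ?thesis by blast
  qed
qed auto

text \<open>The extra factor only shifts the twist from \<open>\<xi>\<close> to
  \<open>\<xi> + \<mu>\<close>.\<close>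

lemma has_means_mult_cis:
  assumes "has_means f"
  shows "has_means (\<lambda>y. c * cis (\<mu> * y) * f y)"
  unfolding has_means_def
proof (intro conjI allI)
  show "continuous_on UNIV (\<lambda>y. c * cis (\<mu> * y) * f y)"
    using assms unfolding has_means_def by (intro continuous_intros) auto
  fix \<xi>
  obtain L where "((\<lambda>Y. (1 / Y) *\<^sub>R integral {0..Y} (\<lambda>y. f y * cis ((\<xi> + \<mu>) * y))) \<longlongrightarrow> L) at_top"
    using assms unfolding has_means_def by blast
  then have "((\<lambda>Y. c * ((1 / Y) *\<^sub>R integral {0..Y} (\<lambda>y. f y * cis ((\<xi> + \<mu>) * y)))) \<longlongrightarrow> c * L) at_top"
    by (rule tendsto_mult_left)
  also have "(\<lambda>Y. c * ((1 / Y) *\<^sub>R integral {0..Y} (\<lambda>y. f y * cis ((\<xi> + \<mu>) * y)))) =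
      (\<lambda>Y. (1 / Y) *\<^sub>R integral {0..Y} (\<lambda>y. c * cis (\<mu> * y) * f y * cis (\<xi> * y)))"
  proof
    fix Y
    have "c * cis (\<mu> * y) * f y * cis (\<xi> * y) = c * (f y * cis ((\<xi> + \<mu>) * y))" for y
      unfolding distrib_right cis_mult[symmetric] by (simp only: mult_ac)
    then show "c * ((1 / Y) *\<^sub>R integral {0..Y} (\<lambda>y. f y * cis ((\<xi> + \<mu>) * y))) =
      (1 / Y) *\<^sub>R integral {0..Y} (\<lambda>y. c * cis (\<mu> * y) * f y * cis (\<xi> * y))"
      by (simp only: integral_mult_right mult_scaleR_right)
  qed
  finally show "\<exists>L. ((\<lambda>Y. (1 / Y) *\<^sub>R integral {0..Y} (\<lambda>y. c * cis (\<mu> * y) * f y * cis (\<xi> * y))) \<longlongrightarrow> L) at_top"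
    by blast
qed

lemma has_means_const_mult: "has_means f \<Longrightarrow> has_means (\<lambda>y. c * f y)"
  using has_means_mult_cis[of f c 0] by simp

lemma has_means_add:
  assumes "has_means f" "has_means g"
  shows "has_means (\<lambda>y. f y + g y)"
  unfolding has_means_def
proof (intro conjI allI)
  have cont: "continuous_on S f" "continuous_on S g" for S
    using assms unfolding has_means_def by (auto intro: continuous_on_subset)
  show "continuous_on UNIV (\<lambda>y. f y + g y)" by (intro continuous_intros cont)
  fix \<xi>
  obtain L M where "((\<lambda>Y. (1 / Y) *\<^sub>R integral {0..Y} (\<lambda>y. f y * cis (\<xi> * y))) \<longlongrightarrow> L) at_top"
    "((\<lambda>Y. (1 / Y) *\<^sub>R integral {0..Y} (\<lambda>y. g y * cis (\<xi> * y))) \<longlongrightarrow> M) at_top"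
    using assms unfolding has_means_def by blast
  then have "((\<lambda>Y. (1 / Y) *\<^sub>R integral {0..Y} (\<lambda>y. f y * cis (\<xi> * y)) +
      (1 / Y) *\<^sub>R integral {0..Y} (\<lambda>y. g y * cis (\<xi> * y))) \<longlongrightarrow> L + M) at_top"
    by (rule tendsto_add)
  moreover have "(1 / Y) *\<^sub>R integral {0..Y} (\<lambda>y. (f y + g y) * cis (\<xi> * y)) =
      (1 / Y) *\<^sub>R integral {0..Y} (\<lambda>y. f y * cis (\<xi> * y)) + (1 / Y) *\<^sub>R integral {0..Y} (\<lambda>y. g y * cis (\<xi> * y))" for Y
    unfolding distrib_right
    by (subst integral_add) (auto intro!: integrable_continuous_real continuous_intros cont simp: scaleR_add_right)
  ultimately show "\<exists>L. ((\<lambda>Y. (1 / Y) *\<^sub>R integral {0..Y} (\<lambda>y. (f y + g y) * cis (\<xi> * y))) \<longlongrightarrow> L) at_top"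
    by auto
qed

lemma has_means_sum:
  assumes "finite N" "\<And>n. n \<in> N \<Longrightarrow> has_means (f n)"
  shows "has_means (\<lambda>y. \<Sum>n\<in>N. f n y)"
  using assms
proof (induction N)
  case empty
  show ?case using has_means_const_mult[OF has_means_one, of 0] by simp
next
  case (insert n N)
  then show ?case using has_means_add[of "f n" "\<lambda>y. \<Sum>n\<in>N. f n y"] by simp
qed

text \<open>Twisting by a unimodular factor keeps distances, so the means of \<open>f\<close> stay
  within \<open>e / 2\<close> of those of \<open>g\<close> for all \<open>Y > 0\<close>. The latter
  converge, and the Cauchy criterion applies.\<close>

lemma has_means_uniform_limit:
  assumes cont: "continuous_on UNIV f"
    and approx: "\<And>e. e > 0 \<Longrightarrow> \<exists>g. has_means g \<and> (\<forall>y. norm (f y - g y) \<le> e)"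
  shows "has_means f"
  unfolding has_means_def
proof (intro conjI allI cont)
  fix \<xi>
  show "\<exists>L. ((\<lambda>Y. (1 / Y) *\<^sub>R integral {0..Y} (\<lambda>y. f y * cis (\<xi> * y))) \<longlongrightarrow> L) at_top"
  proof (rule convergent_if_approximable)
    fix e :: real assume "e > 0"
    then obtain g where g: "has_means g" "\<And>y. norm (f y - g y) \<le> e / 2" using approx[of "e / 2"] by auto
    obtain L where L: "((\<lambda>Y. (1 / Y) *\<^sub>R integral {0..Y} (\<lambda>y. g y * cis (\<xi> * y))) \<longlongrightarrow> L) at_top"
      using g unfolding has_means_def by blast
    have contS: "continuous_on S f" "continuous_on S g" for S
      using cont g unfolding has_means_def by (auto intro: continuous_on_subset)
    have "e / 2 > 0" using \<open>e > 0\<close> by simp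
    have "eventually (\<lambda>Y. dist ((1 / Y) *\<^sub>R integral {0..Y} (\<lambda>y. f y * cis (\<xi> * y))) L \<le> e) at_top"
      using tendstoD[OF L \<open>e / 2 > 0\<close>] eventually_gt_at_top[of 0]
    proof eventually_elim
      case (elim Y)
      let ?f = "(1 / Y) *\<^sub>R integral {0..Y} (\<lambda>y. f y * cis (\<xi> * y))"
      let ?g = "(1 / Y) *\<^sub>R integral {0..Y} (\<lambda>y. g y * cis (\<xi> * y))"
      have "norm (integral {0..Y} (\<lambda>y. f y * cis (\<xi> * y) - g y * cis (\<xi> * y))) \<le> integral {0..Y} (\<lambda>y. e / 2)"
      proof (rule integral_norm_bound_integral)
        fix y
        have "norm (f y * cis (\<xi> * y) - g y * cis (\<xi> * y)) = norm (f y - g y)"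
          by (simp add: norm_mult flip: left_diff_distrib)
        then show "norm (f y * cis (\<xi> * y) - g y * cis (\<xi> * y)) \<le> e / 2" using g by simp
      qed (auto intro!: integrable_continuous_real continuous_intros contS)
      also have "\<dots> = Y * (e / 2)" using elim by simp
      also have "integral {0..Y} (\<lambda>y. f y * cis (\<xi> * y) - g y * cis (\<xi> * y)) =
          integral {0..Y} (\<lambda>y. f y * cis (\<xi> * y)) - integral {0..Y} (\<lambda>y. g y * cis (\<xi> * y))"
        by (intro integral_diff integrable_continuous_real continuous_intros contS)
      finally have "dist ?f ?g \<le> e / 2"
        unfolding dist_norm scaleR_diff_right[symmetric] norm_scaleR using elim by (simp add: field_simps)
      then show ?case using elim dist_triangle[of ?f L ?g] by simp
    qed
    then show "\<exists>L. eventually (\<lambda>Y. dist ((1 / Y) *\<^sub>R integral {0..Y} (\<lambda>y. f y * cis (\<xi> * y))) L \<le> e) at_top"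
      by blast
  qed simp
qed

lemma trig_poly_bound:
  "\<bar>2 * Re (\<Sum>n\<in>N. r n * exp (\<i> * complex_of_real (lam n * y)))\<bar> \<le> 2 * (\<Sum>n\<in>N. norm (r n))"
proof -
  have "\<bar>Re (\<Sum>n\<in>N. r n * exp (\<i> * complex_of_real (lam n * y)))\<bar>
      \<le> norm (\<Sum>n\<in>N. r n * exp (\<i> * complex_of_real (lam n * y)))" by (rule abs_Re_le_cmod)
  also have "\<dots> \<le> (\<Sum>n\<in>N. norm (r n))"
    by (intro sum_norm_le) (simp add: norm_mult)
  finally show ?thesis by simp
qed

text \<open>As \<open>P\<close> is bounded, the Taylor polynomials of the exponential at
  \<open>\<i> * t * P y\<close> converge uniformly in \<open>y\<close>. They are trigonometric
  polynomials and therefore have means.\<close>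

lemma mean_iexp_trig_poly:
  fixes r :: "'a \<Rightarrow> complex" and lam :: "'a \<Rightarrow> real"
  assumes "finite N"
  defines "P \<equiv> \<lambda>y. 2 * Re (\<Sum>n\<in>N. r n * exp (\<i> * complex_of_real (lam n * y)))"
  shows "\<exists>L. ((\<lambda>Y. (1 / Y) *\<^sub>R integral {0..Y} (\<lambda>y. iexp (t * P y))) \<longlongrightarrow> L) at_top"
proof -
  define R where "R = \<bar>t\<bar> * (2 * (\<Sum>n\<in>N. norm (r n)))"
  \<comment> \<open>Written with conjugates, the real part becomes a sum of exponentials of
    frequencies \<open>lam n\<close> and \<open>- lam n\<close>, so multiplication by
    \<open>P\<close> preserves \<open>has_means\<close>.\<close>
  have P: "complex_of_real (P y) = (\<Sum>n\<in>N. r n * cis (lam n * y)) + (\<Sum>n\<in>N. cnj (r n) * cis (- lam n * y))" for y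
  proof -
    have "cnj (\<Sum>n\<in>N. r n * cis (lam n * y)) = (\<Sum>n\<in>N. cnj (r n) * cis (- lam n * y))"
      by (simp add: cis_cnj)
    then show ?thesis unfolding P_def using complex_add_cnj[of "\<Sum>n\<in>N. r n * cis (lam n * y)"]
      by (simp add: cis_conv_exp)
  qed
  have step: "has_means (\<lambda>y. complex_of_real (P y) * f y)" if "has_means f" for f
    unfolding P distrib_right sum_distrib_right
    by (intro has_means_add has_means_sum has_means_mult_cis that assms)
  have pow: "has_means (\<lambda>y. (\<i> * complex_of_real (t * P y)) ^ k / fact k)" for k
  proof (induction k)
    case 0
    then show ?case using has_means_one by simp
  next
    case (Suc k)
    from has_means_const_mult[OF step[OF this], of "\<i> * t / (Suc k)"] show ?case
      by (simp add: field_simps)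
  qed
  have cont: "continuous_on UNIV P" unfolding P_def by (intro continuous_intros)
  have "has_means (\<lambda>y. iexp (t * P y))"
  proof (rule has_means_uniform_limit)
    show "continuous_on UNIV (\<lambda>y. iexp (t * P y))" by (intro continuous_intros cont)
    fix e :: real assume "e > 0"
    have "(\<lambda>n. R ^ n / fact n) \<longlonglongrightarrow> 0"
      using summable_LIMSEQ_zero[OF summable_exp[of R]] by (simp add: field_simps)
    then have "(\<lambda>n. R ^ Suc n / fact (Suc n)) \<longlonglongrightarrow> 0" by (rule LIMSEQ_Suc)
    from order_tendstoD(2)[OF this \<open>e > 0\<close>] obtain n where n: "R ^ Suc n / fact (Suc n) < e"
      unfolding eventually_sequentially by (elim exE) (drule spec, drule mp, rule order_refl)
    have "norm (iexp (t * P y) - (\<Sum>k\<le>n. (\<i> * complex_of_real (t * P y)) ^ k / fact k)) \<le> e" for y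
    proof -
      have "\<bar>t * P y\<bar> \<le> R"
        unfolding R_def abs_mult[of t] P_def by (intro mult_left_mono trig_poly_bound abs_ge_zero)
      then have "\<bar>t * P y\<bar> ^ Suc n / fact (Suc n) \<le> R ^ Suc n / fact (Suc n)"
        by (intro divide_right_mono power_mono) auto
      with iexp_approx1[of "t * P y" n] n show ?thesis by linarith
    qed
    moreover have "has_means (\<lambda>y. \<Sum>k\<le>n. (\<i> * complex_of_real (t * P y)) ^ k / fact k)"
      by (intro has_means_sum pow) auto
    ultimately show "\<exists>g. has_means g \<and> (\<forall>y. norm (iexp (t * P y) - g y) \<le> e)" by blast
  qed
  \<comment> \<open>The twist \<open>\<xi> = 0\<close> gives the plain mean.\<close>
  then obtain L where "((\<lambda>Y. (1 / Y) *\<^sub>R integral {0..Y} (\<lambda>y. iexp (t * P y) * cis (0 * y))) \<longlongrightarrow> L) at_top"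
    unfolding has_means_def by blast
  then show ?thesis by auto
qed

section \<open>Mean square approximation by partial sums\<close>

definition partial_trig_sum :: "(nat \<Rightarrow> real) \<Rightarrow> (nat \<Rightarrow> complex) \<Rightarrow> real \<Rightarrow> real \<Rightarrow> real" where
  "partial_trig_sum lam r T y =
     2 * Re (\<Sum>n | 0 < lam n \<and> lam n \<le> T. r n * exp (\<i> * complex_of_real (lam n * y)))"

lemma continuous_on_partial_trig_sum [continuous_intros]:
  "continuous_on S (partial_trig_sum lam r T)"
  unfolding partial_trig_sum_def by (intro continuous_intros)

text \<open>If \<open>x^2 > \<epsilon>\<close>, then
  \<open>\<bar>x\<bar> powr p = (x^2) powr (p / 2 - 1) * x^2\<close> is at least
  \<open>\<epsilon> powr (p / 2 - 1) * x^2\<close>, because \<open>p \<ge> 2\<close>. This pointwise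
  form passes from p-th power means to mean squares by plain integration.\<close>

lemma square_le_powr:
  fixes x \<epsilon> p :: real
  assumes "p \<ge> 2" "\<epsilon> > 0"
  shows "x^2 \<le> \<epsilon> + \<epsilon> powr (1 - p / 2) * \<bar>x\<bar> powr p"
proof (cases "x^2 \<le> \<epsilon>")
  case True
  moreover have "0 \<le> \<epsilon> powr (1 - p / 2) * \<bar>x\<bar> powr p" by simp
  ultimately show ?thesis by linarith
next
  case False
  then have x: "x^2 > \<epsilon>" "x \<noteq> 0" using assms by auto
  have "\<bar>x\<bar> powr p = (x^2) powr (p / 2)"
    using x powr_powr[of "\<bar>x\<bar>" 2 "p / 2"] by (simp add: powr_numeral)
  also have "(x^2) powr (p / 2) = (x^2) powr (p / 2 - 1) * x^2"
    using x by (subst powr_diff) simp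
  finally have 1: "\<bar>x\<bar> powr p = (x^2) powr (p / 2 - 1) * x^2" .
  have "\<epsilon> powr (p / 2 - 1) \<le> (x^2) powr (p / 2 - 1)" using x assms by (intro powr_mono2) auto
  then have "\<epsilon> powr (1 - p / 2) * \<epsilon> powr (p / 2 - 1) \<le> \<epsilon> powr (1 - p / 2) * (x^2) powr (p / 2 - 1)"
    by (intro mult_left_mono) auto
  moreover have "\<epsilon> powr (1 - p / 2) * \<epsilon> powr (p / 2 - 1) = 1"
    unfolding powr_add[symmetric] using assms by simp
  ultimately have "1 \<le> \<epsilon> powr (1 - p / 2) * (x^2) powr (p / 2 - 1)" by simp
  then have "1 * x^2 \<le> (\<epsilon> powr (1 - p / 2) * (x^2) powr (p / 2 - 1)) * x^2"
    by (intro mult_right_mono) auto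
  then show ?thesis unfolding 1 using assms by (simp add: mult.assoc)
qed

text \<open>The difference of the partial sums is \<open>2 * Re (Q y)\<close>, which explains the
  factor 4; lowering the left end from \<open>y0\<close> to 0 only enlarges the integral.\<close>

lemma nn_integral_mean_square_tail_le:
  fixes lam :: "nat \<Rightarrow> real" and r :: "nat \<Rightarrow> complex"
  assumes "\<And>n. lam n > 0" and fin: "\<And>X. finite {n. lam n \<le> X}" and "K > 0" and "\<beta> > 1 / 2"
    and "\<And>k. (\<Sum>n | nat \<lfloor>lam n\<rfloor> = k. norm (r n)) \<le> K * (real k + 1) powr (- \<beta>)"
    and T: "1 \<le> T" "T \<le> X" and Y: "Y \<ge> 1" and y0: "y0 \<ge> 0"
  shows "(\<integral>\<^sup>+y\<in>{y0..Y}. ennreal ((partial_trig_sum lam r X y - partial_trig_sum lam r T y)^2) \<partial>lebesgue)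
    \<le> ennreal (4 * (600 * Y * (K^2 * (T powr (1 - 2 * \<beta>) * 2 powr (2 * \<beta> - 1) / (2 * \<beta> - 1)))))"
proof -
  define Q where "Q y = (\<Sum>n | T < lam n \<and> lam n \<le> X. r n * cis (lam n * y))" for y
  have le: "(partial_trig_sum lam r X y - partial_trig_sum lam r T y)^2 \<le> 4 * (cmod (Q y))^2" for y
  proof -
    have "{n. 0 < lam n \<and> lam n \<le> X} = {n. 0 < lam n \<and> lam n \<le> T} \<union> {n. T < lam n \<and> lam n \<le> X}"
      using T by auto
    moreover have "finite {n. 0 < lam n \<and> lam n \<le> T}" "finite {n. T < lam n \<and> lam n \<le> X}"
      by (auto intro: finite_subset[OF _ fin[of X]] finite_subset[OF _ fin[of T]])
    ultimately have "(\<Sum>n | 0 < lam n \<and> lam n \<le> X. r n * exp (\<i> * complex_of_real (lam n * y))) =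
        (\<Sum>n | 0 < lam n \<and> lam n \<le> T. r n * exp (\<i> * complex_of_real (lam n * y))) + Q y"
      unfolding Q_def cis_conv_exp by (simp only:) (subst sum.union_disjoint; force)
    then have "partial_trig_sum lam r X y - partial_trig_sum lam r T y = 2 * Re (Q y)"
      unfolding partial_trig_sum_def by simp
    moreover have "(Re (Q y))^2 \<le> (cmod (Q y))^2"
      using abs_Re_le_cmod[of "Q y"] by (simp add: power2_le_iff_abs_le)
    ultimately show ?thesis by (simp add: power_mult_distrib)
  qed
  have cont: "continuous_on S (\<lambda>y. 4 * (cmod (Q y))^2)" for S
    unfolding Q_def by (intro continuous_intros)
  have int: "((\<lambda>y. 4 * (cmod (Q y))^2) has_integral (4 * integral {0..Y} (\<lambda>y. (cmod (Q y))^2))) {0..Y}"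
    unfolding integral_mult_right[symmetric]
    by (intro integrable_integral integrable_continuous_real cont)
  have "(\<integral>\<^sup>+y\<in>{y0..Y}. ennreal ((partial_trig_sum lam r X y - partial_trig_sum lam r T y)^2) \<partial>lebesgue)
      \<le> (\<integral>\<^sup>+y. ennreal (indicator {0..Y} y * (4 * (cmod (Q y))^2)) \<partial>lebesgue)"
    using le y0 by (intro nn_integral_mono) (auto simp: indicator_def intro!: ennreal_leI)
  also have "\<dots> = ennreal (4 * integral {0..Y} (\<lambda>y. (cmod (Q y))^2))"
    unfolding nn_integral_completion
    by (rule nn_integral_has_integral_lebesgue) (use int in auto)
  also have "\<dots> \<le> ennreal (4 * (600 * Y * (K^2 * (T powr (1 - 2 * \<beta>) * 2 powr (2 * \<beta> - 1) / (2 * \<beta> - 1)))))"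
    unfolding Q_def by (intro ennreal_leI mult_left_mono mean_square_tail_le) (use assms in auto)
  finally show ?thesis .
qed

text \<open>With \<open>X = Xf Y\<close>, the difference \<open>\<phi> - P_T\<close> splits into
  \<open>P_X - P_T\<close> and the error \<open>E y X\<close>. The first has a mean square bound
  uniform in \<open>X\<close>, so the dependence of \<open>X\<close> on \<open>Y\<close> is
  harmless; the second has p-th power mean tending to 0. The constant \<open>A\<close> does not
  depend on \<open>T\<close>; only the threshold for \<open>Y\<close> does.\<close>

lemma mean_square_approx:
  assumes exp: "p_function_expansion p \<phi> lam r y0 X0" and p: "p \<ge> 2"
    and fin: "\<And>X. finite {n. lam n \<le> X}" and K: "K > 0" and \<beta>: "\<beta> > 1 / 2"
    and bd: "\<And>k. (\<Sum>n | nat \<lfloor>lam n\<rfloor> = k. norm (r n)) \<le> K * (real k + 1) powr (- \<beta>)"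
  obtains A where "A > 0" "\<And>T. T \<ge> 1 \<Longrightarrow> eventually (\<lambda>Y.
    (\<integral>\<^sup>+y\<in>{y0..Y}. ennreal ((\<phi> y - partial_trig_sum lam r T y)^2) \<partial>lebesgue)
      \<le> ennreal (Y * (A * T powr (1 - 2 * \<beta>)))) at_top"
proof
  define c where "c = 600 * (K^2 * (2 powr (2 * \<beta> - 1) / (2 * \<beta> - 1)))"
  have c: "c \<ge> 0" unfolding c_def using \<beta> by simp
  \<comment> \<open>Squaring a sum costs a factor 2: the tail of the series gives
    \<open>2 * 4 * c\<close>, and the error gives 2 for the level \<open>\<epsilon>\<close> and 2
    for its p-th power mean.\<close>
  show "8 * c + 4 > 0" using c by linarith
  fix T :: real assume T: "T \<ge> 1"
  \<comment> \<open>The level has the order of the bound aimed at, so the error term contributes no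
    more than the tail of the series.\<close>
  define \<epsilon> where "\<epsilon> = T powr (1 - 2 * \<beta>)"
  define b where "b = \<epsilon> powr (1 - p / 2)"
  have \<epsilon>: "\<epsilon> > 0" using T by (simp add: \<epsilon>_def)
  have b: "b > 0" using \<epsilon> by (simp add: b_def)
  have pos: "lam n > 0" for n using exp unfolding p_function_expansion_def by blast
  have y0: "y0 > 0" using exp unfolding p_function_expansion_def by blast
  obtain E Xf where
    E: "\<And>y X. y \<ge> y0 \<Longrightarrow> X \<ge> X0 \<Longrightarrow> \<phi> y = partial_trig_sum lam r X y + E y X"
    and Xf: "filterlim Xf at_top at_top"
    and lim: "((\<lambda>Y. ennreal (1 / Y) * (\<integral>\<^sup>+ y\<in>{y0..Y}. ennreal (\<bar>E y (Xf Y)\<bar> powr p) \<partial>lebesgue)) \<longlongrightarrow> 0) at_top"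
    using exp unfolding p_function_expansion_def partial_trig_sum_def by blast
  have meas: "(\<lambda>y. if y \<in> {0..} then \<phi> y else 0) \<in> borel_measurable lebesgue"
    using exp unfolding p_function_expansion_def by (subst borel_measurable_if) auto
  \<comment> \<open>Dividing by \<open>b\<close> compensates the factor \<open>b\<close> that
    \<open>square_le_powr\<close> puts in front of the p-th power.\<close>
  have "eventually (\<lambda>Y. ennreal (1 / Y) * (\<integral>\<^sup>+ y\<in>{y0..Y}. ennreal (\<bar>E y (Xf Y)\<bar> powr p) \<partial>lebesgue)
      < ennreal (\<epsilon> / b)) at_top"
    using \<epsilon> b by (intro order_tendstoD(2)[OF lim]) auto
  moreover have "eventually (\<lambda>Y. Xf Y \<ge> max X0 T) at_top"
    using Xf unfolding filterlim_at_top by blast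
  ultimately show "eventually (\<lambda>Y. (\<integral>\<^sup>+y\<in>{y0..Y}. ennreal ((\<phi> y - partial_trig_sum lam r T y)^2) \<partial>lebesgue)
      \<le> ennreal (Y * ((8 * c + 4) * T powr (1 - 2 * \<beta>)))) at_top"
    using eventually_ge_at_top[of "max 1 y0"]
  proof eventually_elim
    case (elim Y)
    define X where "X = Xf Y"
    define I where "I = (\<integral>\<^sup>+ y\<in>{y0..Y}. ennreal (\<bar>E y X\<bar> powr p) \<partial>lebesgue)"
    \<comment> \<open>No measurability of \<open>E\<close> is assumed. \<open>G\<close> agrees with
      \<open>E y X\<close> on \<open>[y0, Y]\<close> and is measurable on the whole line, as
      \<open>\<phi>\<close> is extended by 0.\<close>
    define G where "G y = (\<lambda>y. if y \<in> {0..} then \<phi> y else 0) y - partial_trig_sum lam r X y" for y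
    define H where "H y = partial_trig_sum lam r X y - partial_trig_sum lam r T y" for y
    have Y: "Y \<ge> 1" "Y \<ge> y0" "X \<ge> X0" "X \<ge> T" using elim by (auto simp: X_def)
    have pmeas [measurable]: "partial_trig_sum lam r Z \<in> borel_measurable lebesgue" for Z
      using borel_measurable_continuous_onI[OF continuous_on_partial_trig_sum, of lam r Z]
      by (intro measurable_completion) simp
    have [measurable]: "G \<in> borel_measurable lebesgue" "H \<in> borel_measurable lebesgue"
      unfolding G_def H_def using meas by measurable
    have [measurable]: "{y0..Y} \<in> sets lebesgue" by simp
    have GE: "G y = E y X" if "y \<in> {y0..Y}" for y
      using E[of y X] that Y y0 by (auto simp: G_def)
    have I_eq: "I = (\<integral>\<^sup>+ y\<in>{y0..Y}. ennreal (\<bar>G y\<bar> powr p) \<partial>lebesgue)"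
      unfolding I_def by (intro nn_integral_cong) (auto simp: GE indicator_def)
    have "I = ennreal Y * (ennreal (1 / Y) * I)"
      using Y by (simp flip: mult.assoc ennreal_mult)
    also have "\<dots> \<le> ennreal Y * ennreal (\<epsilon> / b)"
      using elim(1) unfolding I_def X_def by (intro mult_left_mono) auto
    also have "\<dots> = ennreal (Y * (\<epsilon> / b))" using Y \<epsilon> b by (intro ennreal_mult[symmetric]) auto
    finally have I: "I \<le> ennreal (Y * (\<epsilon> / b))" .
    have "(\<integral>\<^sup>+y\<in>{y0..Y}. ennreal ((\<phi> y - partial_trig_sum lam r T y)^2) \<partial>lebesgue)
       \<le> (\<integral>\<^sup>+y. 2 * (ennreal ((H y)^2) * indicator {y0..Y} y) +
            (ennreal (2 * \<epsilon>) * indicator {y0..Y} y +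
             ennreal (2 * b) * (ennreal (\<bar>G y\<bar> powr p) * indicator {y0..Y} y)) \<partial>lebesgue)"
    proof (rule nn_integral_mono)
      fix y
      show "ennreal ((\<phi> y - partial_trig_sum lam r T y)^2) * indicator {y0..Y} y
        \<le> 2 * (ennreal ((H y)^2) * indicator {y0..Y} y) +
            (ennreal (2 * \<epsilon>) * indicator {y0..Y} y +
             ennreal (2 * b) * (ennreal (\<bar>G y\<bar> powr p) * indicator {y0..Y} y))"
      proof (cases "y \<in> {y0..Y}")
        case True
        then have "\<phi> y - partial_trig_sum lam r T y = H y + G y"
          using y0 by (simp add: H_def G_def)
        then have "(\<phi> y - partial_trig_sum lam r T y)^2 \<le> 2 * (H y)^2 + 2 * (G y)^2"
          using sum_squares_bound[of "H y" "G y"] by (simp add: power2_sum)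
        also have "\<dots> \<le> 2 * (H y)^2 + (2 * \<epsilon> + 2 * b * (\<bar>G y\<bar> powr p))"
          using square_le_powr[OF p \<epsilon>, of "G y"] unfolding b_def by simp
        finally have "ennreal ((\<phi> y - partial_trig_sum lam r T y)^2) \<le>
            ennreal (2 * (H y)^2 + (2 * \<epsilon> + 2 * b * (\<bar>G y\<bar> powr p)))" by (rule ennreal_leI)
        also have "\<dots> = 2 * ennreal ((H y)^2) + (ennreal (2 * \<epsilon>) + ennreal (2 * b) * ennreal (\<bar>G y\<bar> powr p))"
          using \<epsilon> b by (simp add: ennreal_mult)
        finally show ?thesis using True by simp
      qed simp
    qed
    also have "\<dots> = 2 * (\<integral>\<^sup>+y\<in>{y0..Y}. ennreal ((H y)^2) \<partial>lebesgue) +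
        (ennreal (2 * \<epsilon>) * emeasure lebesgue {y0..Y} + ennreal (2 * b) * I)"
      unfolding I_eq by (simp add: nn_integral_add nn_integral_cmult)
    also have "\<dots> \<le> 2 * ennreal (4 * (c * Y * \<epsilon>)) + (ennreal (2 * \<epsilon>) * ennreal Y + ennreal (2 * b) * ennreal (Y * (\<epsilon> / b)))"
    proof (intro add_mono mult_left_mono I)
      have "(\<integral>\<^sup>+y\<in>{y0..Y}. ennreal ((H y)^2) \<partial>lebesgue) \<le>
          ennreal (4 * (600 * Y * (K^2 * (T powr (1 - 2 * \<beta>) * 2 powr (2 * \<beta> - 1) / (2 * \<beta> - 1)))))"
        unfolding H_def
        by (rule nn_integral_mean_square_tail_le) (use pos fin K \<beta> bd T Y y0 in auto)
      also have "600 * Y * (K^2 * (T powr (1 - 2 * \<beta>) * 2 powr (2 * \<beta> - 1) / (2 * \<beta> - 1))) = c * Y * \<epsilon>"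
        by (simp add: c_def \<epsilon>_def)
      finally show "(\<integral>\<^sup>+y\<in>{y0..Y}. ennreal ((H y)^2) \<partial>lebesgue) \<le> ennreal (4 * (c * Y * \<epsilon>))" .
      show "emeasure lebesgue {y0..Y} \<le> ennreal Y" using Y y0 by (simp add: ennreal_leI)
    qed auto
    also have "\<dots> = ennreal (2 * (4 * (c * Y * \<epsilon>)) + (2 * \<epsilon> * Y + 2 * b * (Y * (\<epsilon> / b))))"
    proof -
      have "ennreal (2 * (4 * (c * Y * \<epsilon>))) = 2 * ennreal (4 * (c * Y * \<epsilon>))"
        "ennreal (2 * \<epsilon> * Y) = ennreal (2 * \<epsilon>) * ennreal Y"
        "ennreal (2 * b * (Y * (\<epsilon> / b))) = ennreal (2 * b) * ennreal (Y * (\<epsilon> / b))"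
        using c \<epsilon> b Y by (subst ennreal_mult, simp_all del: times_divide_eq_right)+
      then show ?thesis using c \<epsilon> b Y by (simp del: times_divide_eq_right)
    qed
    also have "2 * (4 * (c * Y * \<epsilon>)) + (2 * \<epsilon> * Y + 2 * b * (Y * (\<epsilon> / b))) = Y * ((8 * c + 4) * T powr (1 - 2 * \<beta>))"
      using b unfolding \<epsilon>_def[symmetric] by (simp add: field_simps)
    finally show ?case .
  qed
qed

section \<open>Limits of empirical laws\<close>

lemma real_distribution_tail:
  assumes "real_distribution M" "\<epsilon> > 0"
  obtains b where "measure M {- b<..b} > 1 - \<epsilon>"
proof -
  interpret real_distribution M by fact
  have "(\<lambda>n. measure M {- real n<..real n}) \<longlonglongrightarrow> measure M (\<Union>n. {- real n<..real n})"
    by (intro finite_Lim_measure_incseq) (auto simp: incseq_def)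
  also have "(\<Union>n. {- real n<..real n}) = UNIV"
  proof -
    have "x \<in> {- real (nat \<lceil>\<bar>x\<bar>\<rceil> + 1)<..real (nat \<lceil>\<bar>x\<bar>\<rceil> + 1)}" for x :: real
      unfolding greaterThanAtMost_iff by linarith
    then show ?thesis by blast
  qed
  also have "measure M UNIV = 1" using prob_space by simp
  finally have "eventually (\<lambda>n. measure M {- real n<..real n} > 1 - \<epsilon>) sequentially"
    using assms(2) by (intro order_tendstoD(1)) auto
  then show ?thesis using that by (auto simp: eventually_sequentially)
qed

text \<open>Tightness asks for one interval for all \<open>n\<close>; the finitely many early laws
  are each tight and are absorbed by enlarging the interval.\<close>

lemma tight_if_eventually:
  assumes dist: "\<And>n. real_distribution (\<nu> n)"
    and ev: "\<And>\<epsilon>. \<epsilon> > 0 \<Longrightarrow> \<exists>B. eventually (\<lambda>n. measure (\<nu> n) {x. \<bar>x\<bar> \<ge> B} < \<epsilon>) sequentially"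
  shows "tight \<nu>"
  unfolding tight_def
proof (intro conjI allI impI dist)
  fix \<epsilon> :: real assume "\<epsilon> > 0"
  interpret real_distribution "\<nu> n" for n by (rule dist)
  obtain B N where B: "\<And>n. n \<ge> N \<Longrightarrow> measure (\<nu> n) {x. \<bar>x\<bar> \<ge> B} < \<epsilon>"
    using ev[OF \<open>\<epsilon> > 0\<close>] unfolding eventually_sequentially by blast
  have "\<exists>b. measure (\<nu> n) {- b<..b} > 1 - \<epsilon>" for n
    using real_distribution_tail[OF dist \<open>\<epsilon> > 0\<close>] by blast
  then obtain b where b: "\<And>n. measure (\<nu> n) {- b n<..b n} > 1 - \<epsilon>" by metis
  \<comment> \<open>Including 1 guarantees that the interval from \<open>- c\<close> to
    \<open>c\<close> is not degenerate.\<close>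
  define c where "c = Max (insert 1 (insert B (b ` {..<N})))"
  have "x \<le> c" if "x \<in> insert 1 (insert B (b ` {..<N}))" for x
    unfolding c_def by (rule Max_ge) (use that in auto)
  then have c: "c \<ge> 1" "c \<ge> B" "n < N \<Longrightarrow> c \<ge> b n" for n by auto
  have "measure (\<nu> n) {- c<..c} > 1 - \<epsilon>" for n
  proof (cases "n < N")
    case True
    have "measure (\<nu> n) {- b n<..b n} \<le> measure (\<nu> n) {- c<..c}"
      using c(3)[OF True] by (intro finite_measure_mono) auto
    with b[of n] show ?thesis by linarith
  next
    case False
    have [measurable]: "{x. \<bar>x\<bar> \<ge> B} \<in> sets borel" by measurable
    have "1 - measure (\<nu> n) {x. \<bar>x\<bar> \<ge> B} = measure (\<nu> n) (space (\<nu> n) - {x. \<bar>x\<bar> \<ge> B})"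
      by (subst prob_compl) auto
    also have "\<dots> \<le> measure (\<nu> n) {- c<..c}" using c(2) by (intro finite_measure_mono) auto
    finally show ?thesis using B[of n] False by simp
  qed
  then show "\<exists>a b. a < b \<and> (\<forall>n. 1 - \<epsilon> < measure (\<nu> n) {a<..b})"
    using c(1) by (intro exI[of _ "- c"] exI[of _ c]) auto
qed

text \<open>Helly's theorem along the integers yields a candidate \<open>\<mu>\<close> from a
  subsequence. Since the characteristic functions converge as \<open>Y\<close> grows continuously,
  their limit must be that of \<open>\<mu>\<close>, and Levy's theorem along every sequence tending
  to infinity gives the full limit.\<close>

lemma weak_limit_exists:
  fixes \<nu> :: "real \<Rightarrow> real measure"
  assumes dist: "\<And>Y. Y > 0 \<Longrightarrow> real_distribution (\<nu> Y)"
    and tight: "\<And>\<epsilon>. \<epsilon> > 0 \<Longrightarrow> \<exists>B. eventually (\<lambda>Y. measure (\<nu> Y) {x. \<bar>x\<bar> \<ge> B} < \<epsilon>) at_top"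
    and char: "\<And>t. \<exists>L. ((\<lambda>Y. char (\<nu> Y) t) \<longlongrightarrow> L) at_top"
  obtains \<mu> where "real_distribution \<mu>"
    "\<And>g :: real \<Rightarrow> real. continuous_on UNIV g \<Longrightarrow> bounded (range g) \<Longrightarrow>
       ((\<lambda>Y. LINT x|\<nu> Y. g x) \<longlongrightarrow> (LINT x|\<mu>. g x)) at_top"
proof -
  define seq where "seq n = \<nu> (real n + 1)" for n
  have dist_seq: "real_distribution (seq n)" for n unfolding seq_def by (intro dist) auto
  have at_top: "filterlim (\<lambda>n. real n + 1) at_top sequentially"
    by (rule filterlim_at_top_mono[OF filterlim_real_sequentially]) simp
  have "tight seq"
  proof (rule tight_if_eventually[OF dist_seq])
    fix \<epsilon> :: real assume "\<epsilon> > 0"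
    with tight obtain B where "eventually (\<lambda>Y. measure (\<nu> Y) {x. \<bar>x\<bar> \<ge> B} < \<epsilon>) at_top" by blast
    from eventually_compose_filterlim[OF this at_top]
    show "\<exists>B. eventually (\<lambda>n. measure (seq n) {x. \<bar>x\<bar> \<ge> B} < \<epsilon>) sequentially"
      unfolding seq_def by blast
  qed
  then obtain s \<mu> where s: "strict_mono s" and \<mu>: "real_distribution \<mu>" and w: "weak_conv_m (seq \<circ> s) \<mu>"
    using tight_imp_convergent_subsubsequence[OF _ strict_mono_id, of seq] by auto
  have char_\<mu>: "((\<lambda>Y. char (\<nu> Y) t) \<longlongrightarrow> char \<mu> t) at_top" for t
  proof -
    obtain L where L: "((\<lambda>Y. char (\<nu> Y) t) \<longlongrightarrow> L) at_top" using char by blast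
    have "filterlim (\<lambda>n. real (s n) + 1) at_top sequentially"
      using filterlim_compose[OF at_top filterlim_subseq[OF s]] .
    from filterlim_compose[OF L this] have "(\<lambda>n. char ((seq \<circ> s) n) t) \<longlonglongrightarrow> L"
      by (simp add: seq_def)
    moreover have "(\<lambda>n. char ((seq \<circ> s) n) t) \<longlonglongrightarrow> char \<mu> t"
      by (rule levy_continuity1[OF _ \<mu> w]) (simp add: dist_seq)
    ultimately have "L = char \<mu> t" by (rule LIMSEQ_unique)
    with L show ?thesis by simp
  qed
  have "((\<lambda>Y. LINT x|\<nu> Y. g x) \<longlongrightarrow> (LINT x|\<mu>. g x)) at_top"
    if g: "continuous_on UNIV g" "bounded (range g)" for g :: "real \<Rightarrow> real"
  proof (rule tendsto_at_topI_sequentially)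
    fix Z :: "nat \<Rightarrow> real" assume Z: "filterlim Z at_top sequentially"
    obtain B where B: "\<And>x. norm (g x) \<le> B" using g(2) unfolding bounded_iff by auto
    \<comment> \<open>The laws are probability measures only for \<open>Y > 0\<close>; truncating at
      1 changes finitely many terms.\<close>
    define Z' where "Z' n = max 1 (Z n)" for n
    have ev: "eventually (\<lambda>n. Z' n = Z n) sequentially"
      using Z[unfolded filterlim_at_top, rule_format, of 1] by eventually_elim (simp add: Z'_def)
    have Z'_top: "filterlim Z' at_top sequentially"
      using Z ev by (subst filterlim_cong[OF refl refl ev])
    have distZ: "real_distribution (\<nu> (Z' n))" for n by (rule dist) (simp add: Z'_def)
    have "weak_conv_m (\<lambda>n. \<nu> (Z' n)) \<mu>"
      by (rule levy_continuity[OF distZ \<mu>]) (rule filterlim_compose[OF char_\<mu> Z'_top])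
    then have "(\<lambda>n. LINT x|\<nu> (Z' n). g x) \<longlonglongrightarrow> (LINT x|\<mu>. g x)"
      by (rule weak_conv_imp_integral_bdd_continuous_conv[OF distZ \<mu> _ _ B])
        (use g(1) in \<open>auto simp: continuous_on_eq_continuous_at\<close>)
    moreover have "eventually (\<lambda>n. (LINT x|\<nu> (Z' n). g x) = (LINT x|\<nu> (Z n). g x)) sequentially"
      using ev by eventually_elim simp
    ultimately show "(\<lambda>n. LINT x|\<nu> (Z n). g x) \<longlonglongrightarrow> (LINT x|\<mu>. g x)"
      by (rule Lim_transform_eventually)
  qed
  with \<mu> show ?thesis by (rule that)
qed

text \<open>The uniform law on \<open>[0, Y]\<close>, taken on the Lebesgue sets because
  \<open>\<phi>\<close> is only Lebesgue measurable. Its image under \<open>\<phi>\<close> is the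
  empirical law.\<close>

definition uniform_upto :: "real \<Rightarrow> real measure" where
  "uniform_upto Y = density lebesgue (\<lambda>y. ennreal (indicator {0..Y} y / Y))"

lemma sets_uniform_upto [simp, measurable_cong]: "sets (uniform_upto Y) = sets lebesgue"
  by (simp add: uniform_upto_def)

lemma nn_integral_uniform_upto:
  assumes "Y > 0" "f \<in> borel_measurable lebesgue"
  shows "(\<integral>\<^sup>+y. f y \<partial>uniform_upto Y) = ennreal (1 / Y) * (\<integral>\<^sup>+y\<in>{0..Y}. f y \<partial>lebesgue)"
proof -
  have [measurable]: "{0..Y} \<in> sets lebesgue" by simp
  have "(\<integral>\<^sup>+y. f y \<partial>uniform_upto Y) = (\<integral>\<^sup>+y. ennreal (indicator {0..Y} y / Y) * f y \<partial>lebesgue)"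
    unfolding uniform_upto_def using assms by (intro nn_integral_density) auto
  also have "\<dots> = (\<integral>\<^sup>+y. ennreal (1 / Y) * (f y * indicator {0..Y} y) \<partial>lebesgue)"
    by (intro nn_integral_cong) (auto simp: indicator_def)
  also have "\<dots> = ennreal (1 / Y) * (\<integral>\<^sup>+y\<in>{0..Y}. f y \<partial>lebesgue)"
    using assms by (intro nn_integral_cmult) auto
  finally show ?thesis .
qed

lemma prob_space_uniform_upto: "Y > 0 \<Longrightarrow> prob_space (uniform_upto Y)"
  using nn_integral_uniform_upto[of Y "\<lambda>_. 1"]
  by (intro prob_spaceI) (simp add: uniform_upto_def flip: ennreal_mult)

lemma integral_uniform_upto:
  fixes f :: "real \<Rightarrow> 'b::{banach, second_countable_topology}"
  assumes "Y > 0" "f \<in> borel_measurable lebesgue"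
  shows "integral\<^sup>L (uniform_upto Y) f = (1 / Y) *\<^sub>R (LINT y:{0..Y}|lebesgue. f y)"
proof -
  have [measurable]: "{0..Y} \<in> sets lebesgue" by simp
  have "integral\<^sup>L (uniform_upto Y) f = (LINT y|lebesgue. (indicator {0..Y} y / Y) *\<^sub>R f y)"
    unfolding uniform_upto_def using assms by (intro integral_density) auto
  also have "\<dots> = (LINT y|lebesgue. (1 / Y) *\<^sub>R (indicator {0..Y} y *\<^sub>R f y))"
    by (intro Bochner_Integration.integral_cong) auto
  finally show ?thesis unfolding set_lebesgue_integral_def integral_scaleR_right .
qed

text \<open>Converts mean square closeness into a bound for the average of \<open>H\<close>. On the
  initial stretch \<open>[0, y0]\<close> no approximation is available, but the crude bound
  \<open>c\<close> there costs only \<open>c * y0 / Y\<close>, which vanishes in the limit. It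
  serves both the tail cutoff and the characteristic functions.\<close>

lemma nn_integral_uniform_upto_le:
  fixes f P H :: "real \<Rightarrow> real"
  assumes [measurable]: "f \<in> borel_measurable lebesgue" "P \<in> borel_measurable lebesgue" "H \<in> borel_measurable lebesgue"
    and Y: "0 < y0" "y0 \<le> Y" and pos: "0 \<le> c" "0 \<le> \<delta>" "0 \<le> b" "0 \<le> D"
    and I: "(\<integral>\<^sup>+y\<in>{y0..Y}. ennreal ((f y - P y)^2) \<partial>lebesgue) \<le> ennreal (Y * D)"
    and H: "\<And>y. 0 \<le> H y" "\<And>y. H y \<le> c" "\<And>y. y \<ge> y0 \<Longrightarrow> H y \<le> \<delta> + b * (f y - P y)^2"
  shows "(\<integral>\<^sup>+y. ennreal (H y) \<partial>uniform_upto Y) \<le> ennreal (c * y0 / Y + \<delta> + b * D)"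
proof -
  have [measurable]: "{u..v} \<in> sets lebesgue" for u v :: real by simp
  have "(\<integral>\<^sup>+y\<in>{0..Y}. ennreal (H y) \<partial>lebesgue) \<le>
      (\<integral>\<^sup>+y. ennreal c * indicator {0..y0} y + (ennreal \<delta> * indicator {0..Y} y
        + ennreal b * (ennreal ((f y - P y)^2) * indicator {y0..Y} y)) \<partial>lebesgue)"
  proof (rule nn_integral_mono)
    fix y
    show "ennreal (H y) * indicator {0..Y} y \<le> ennreal c * indicator {0..y0} y + (ennreal \<delta> * indicator {0..Y} y
        + ennreal b * (ennreal ((f y - P y)^2) * indicator {y0..Y} y))"
    proof (cases "y \<in> {y0..Y}")
      case True
      then have "ennreal (H y) \<le> ennreal \<delta> + ennreal b * ennreal ((f y - P y)^2)"
        using ennreal_leI[OF H(3)[of y]] pos by (simp add: ennreal_plus ennreal_mult)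
      then show ?thesis using True Y by (simp add: indicator_def add_increasing)
    next
      case False
      then show ?thesis using H(2)[of y] by (auto simp: indicator_def intro!: ennreal_leI add_increasing2)
    qed
  qed
  also have "\<dots> = ennreal c * ennreal y0 + (ennreal \<delta> * ennreal Y
      + ennreal b * (\<integral>\<^sup>+y\<in>{y0..Y}. ennreal ((f y - P y)^2) \<partial>lebesgue))"
    using Y by (simp add: nn_integral_add nn_integral_cmult)
  also have "\<dots> \<le> ennreal c * ennreal y0 + (ennreal \<delta> * ennreal Y + ennreal b * ennreal (Y * D))"
    by (intro add_mono mult_left_mono I order_refl) auto
  also have "\<dots> = ennreal (c * y0 + (\<delta> * Y + b * (Y * D)))"
    using Y pos by (simp add: ennreal_plus ennreal_mult)
  finally have le: "(\<integral>\<^sup>+y\<in>{0..Y}. ennreal (H y) \<partial>lebesgue) \<le> ennreal (c * y0 + (\<delta> * Y + b * (Y * D)))" .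
  have "(\<integral>\<^sup>+y. ennreal (H y) \<partial>uniform_upto Y) = ennreal (1 / Y) * (\<integral>\<^sup>+y\<in>{0..Y}. ennreal (H y) \<partial>lebesgue)"
    using Y by (intro nn_integral_uniform_upto) auto
  also have "\<dots> \<le> ennreal (1 / Y) * ennreal (c * y0 + (\<delta> * Y + b * (Y * D)))"
    by (intro mult_left_mono le) auto
  also have "\<dots> = ennreal (1 / Y * (c * y0 + (\<delta> * Y + b * (Y * D))))"
    using Y pos by (intro ennreal_mult[symmetric]) auto
  also have "1 / Y * (c * y0 + (\<delta> * Y + b * (Y * D))) = c * y0 / Y + \<delta> + b * D"
    using Y by (simp add: field_simps)
  finally show ?thesis .
qed

text \<open>A bounded continuous majorant of the indicator of \<open>\<bar>x\<bar> \<ge> S\<close>,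
  hence an admissible test function for weak convergence. It is the squared distance to
  \<open>[- (S - 1), S - 1]\<close>, capped at 1, when \<open>S \<ge> 1\<close>.\<close>

definition tail_cutoff :: "real \<Rightarrow> real \<Rightarrow> real" where
  "tail_cutoff S x = min 1 ((max 0 (\<bar>x\<bar> - (S - 1)))^2)"

lemma tail_cutoff_bounds: "0 \<le> tail_cutoff S x" "tail_cutoff S x \<le> 1"
  by (auto simp: tail_cutoff_def)

lemma continuous_on_tail_cutoff: "continuous_on A (tail_cutoff S)"
  unfolding tail_cutoff_def by (intro continuous_intros)

lemma borel_measurable_tail_cutoff [measurable]: "tail_cutoff S \<in> borel_measurable borel"
  by (rule borel_measurable_continuous_onI[OF continuous_on_tail_cutoff])

text \<open>Pointwise form of Chebyshev's inequality: \<open>\<bar>x\<bar> - (S - 1) \<le>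
  \<bar>x\<bar> - \<bar>u\<bar> \<le> \<bar>x - u\<bar>\<close>.\<close>

lemma tail_cutoff_le_square:
  assumes "\<bar>u\<bar> \<le> S - 1"
  shows "tail_cutoff S x \<le> (x - u)^2"
proof -
  have "(max 0 (\<bar>x\<bar> - (S - 1)))^2 \<le> \<bar>x - u\<bar>^2" using assms by (intro power_mono) auto
  then show ?thesis by (simp add: tail_cutoff_def min_le_iff_disj)
qed

lemma measure_tail_le_cutoff:
  assumes "real_distribution M"
  shows "measure M {x. \<bar>x\<bar> \<ge> S} \<le> (LINT x|M. tail_cutoff S x)"
proof -
  interpret real_distribution M by fact
  have [measurable]: "{x. \<bar>x\<bar> \<ge> S} \<in> sets borel" by measurable
  have "measure M {x. \<bar>x\<bar> \<ge> S} = (LINT x|M. indicator {x. \<bar>x\<bar> \<ge> S} x)" by simp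
  also have "\<dots> \<le> (LINT x|M. tail_cutoff S x)"
  proof (rule integral_mono)
    show "integrable M (tail_cutoff S)"
      by (rule integrable_const_bound[of _ 1]) (auto simp: tail_cutoff_bounds)
    show "integrable M (\<lambda>x. indicat_real {x. S \<le> \<bar>x\<bar>} x)"
      by (rule integrable_const_bound[of _ 1]) (auto simp: indicator_def)
    fix x
    have "S \<le> \<bar>x\<bar> \<Longrightarrow> 1 \<le> (max 0 (\<bar>x\<bar> - (S - 1)))^2"
      by (intro one_le_power) auto
    then show "indicat_real {x. S \<le> \<bar>x\<bar>} x \<le> tail_cutoff S x"
      by (auto simp: tail_cutoff_def indicator_def)
  qed
  finally show ?thesis .
qed

text \<open>The exponential is 1-Lipschitz, and
  \<open>\<bar>u\<bar> \<le> \<delta> + u^2 / \<delta>\<close> trades the linear bound for a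
  quadratic one that a mean square estimate can control.\<close>

lemma norm_iexp_diff_le:
  fixes x y \<delta> :: real
  assumes "\<delta> > 0"
  shows "norm (iexp x - iexp y) \<le> \<delta> + (x - y)^2 / \<delta>"
proof -
  have "norm (iexp x - iexp y) = norm (iexp y * (iexp (x - y) - 1))"
    by (simp add: right_diff_distrib flip: exp_add)
  also have "\<dots> = norm (iexp (x - y) - 1)" by (simp add: norm_mult)
  also have "\<dots> \<le> \<bar>x - y\<bar>" using iexp_approx1[of "x - y" 0] by simp
  also have "\<dots> \<le> \<delta> + (x - y)^2 / \<delta>"
  proof (cases "\<bar>x - y\<bar> \<le> \<delta>")
    case True
    then show ?thesis using assms by (simp add: add_increasing2)
  next
    case False
    then have "\<bar>x - y\<bar> * \<delta> \<le> \<bar>x - y\<bar> * \<bar>x - y\<bar>" by (intro mult_left_mono) auto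
    then have "\<bar>x - y\<bar> \<le> (x - y)^2 / \<delta>" using assms by (simp add: field_simps power2_eq_square)
    with assms show ?thesis by simp
  qed
  finally show ?thesis .
qed

lemma powr_small:
  fixes s \<epsilon> :: real
  assumes "s < 0" "\<epsilon> > 0"
  obtains T where "T \<ge> 1" "A * T powr s < \<epsilon>"
proof -
  have "((\<lambda>T. A * T powr s) \<longlongrightarrow> 0) at_top"
    by (intro tendsto_mult_right_zero tendsto_neg_powr assms filterlim_ident)
  from eventually_conj[OF order_tendstoD(2)[OF this assms(2)] eventually_ge_at_top[of 1]]
  show ?thesis using that by (auto simp: eventually_at_top_linorder)
qed

text \<open>The condition on \<open>S\<close> forces \<open>\<bar>P_T\<bar> \<le> S - 1\<close>
  everywhere, so \<open>\<phi>\<close> can reach size \<open>S\<close> only where it differs from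
  \<open>P_T\<close> by at least 1. Keeping \<open>T\<close> free leaves its optimisation to the
  separate ranges of \<open>\<beta>\<close>.\<close>

lemma limiting_distribution_with_tail:
  assumes exp: "p_function_expansion p \<phi> lam r y0 X0" and p: "p \<ge> 2"
    and fin: "\<And>X. finite {n. lam n \<le> X}" and K: "K > 0" and \<beta>: "\<beta> > 1 / 2"
    and bd: "\<And>k. (\<Sum>n | nat \<lfloor>lam n\<rfloor> = k. norm (r n)) \<le> K * (real k + 1) powr (- \<beta>)"
  obtains \<mu> A where "limiting_distribution \<phi> \<mu>" "A > 0"
    "\<And>T S. T \<ge> 1 \<Longrightarrow> S \<ge> 2 * (\<Sum>n | lam n \<le> T. norm (r n)) + 1 \<Longrightarrow>
       measure \<mu> ({..- S} \<union> {S..}) \<le> A * T powr (1 - 2 * \<beta>)"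
proof -
  obtain A where A: "A > 0" and approx: "\<And>T. T \<ge> 1 \<Longrightarrow> eventually (\<lambda>Y.
    (\<integral>\<^sup>+y\<in>{y0..Y}. ennreal ((\<phi> y - partial_trig_sum lam r T y)^2) \<partial>lebesgue)
      \<le> ennreal (Y * (A * T powr (1 - 2 * \<beta>)))) at_top"
    using mean_square_approx[OF exp p fin K \<beta> bd] by blast
  have pos: "lam n > 0" for n using exp unfolding p_function_expansion_def by blast
  have y0: "y0 > 0" using exp unfolding p_function_expansion_def by blast
  define f where "f y = (if y \<in> {0..} then \<phi> y else 0)" for y
  define P where "P = partial_trig_sum lam r"
  define D where "D T = A * T powr (1 - 2 * \<beta>)" for T
  define \<nu> where "\<nu> Y = distr (uniform_upto Y) borel f" for Y
  have D0: "D T \<ge> 0" for T using A by (simp add: D_def)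
  have y0Y: "((\<lambda>Y. c * y0 / Y) \<longlongrightarrow> 0) at_top" for c
    by (intro tendsto_divide_0[OF tendsto_const] filterlim_at_top_imp_at_infinity filterlim_ident)
  have f_meas [measurable]: "f \<in> borel_measurable lebesgue"
    using exp unfolding p_function_expansion_def f_def by (subst borel_measurable_if) auto
  have P_meas [measurable]: "P T \<in> borel_measurable lebesgue" for T
    unfolding P_def using borel_measurable_continuous_onI[OF continuous_on_partial_trig_sum, of lam r T]
    by (intro measurable_completion) simp
  have approx_f: "eventually (\<lambda>Y. (\<integral>\<^sup>+y\<in>{y0..Y}. ennreal ((f y - P T y)^2) \<partial>lebesgue) \<le> ennreal (Y * D T)) at_top"
    if "T \<ge> 1" for T
  proof -
    have "(\<integral>\<^sup>+y\<in>{y0..Y}. ennreal ((f y - P T y)^2) \<partial>lebesgue) =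
        (\<integral>\<^sup>+y\<in>{y0..Y}. ennreal ((\<phi> y - partial_trig_sum lam r T y)^2) \<partial>lebesgue)" for Y
      using y0 by (intro nn_integral_cong) (auto simp: indicator_def f_def P_def)
    with approx[OF that] show ?thesis unfolding D_def by simp
  qed
  have distr: "real_distribution (\<nu> Y)" if "Y > 0" for Y
  proof -
    interpret prob_space "uniform_upto Y" using that by (rule prob_space_uniform_upto)
    show ?thesis unfolding \<nu>_def by (rule real_distribution_distr) measurable
  qed
  have integral_\<nu>: "(LINT x|\<nu> Y. g x) = (LINT y|uniform_upto Y. g (f y))"
    if "g \<in> borel_measurable borel" for Y and g :: "real \<Rightarrow> 'b::{banach, second_countable_topology}"
    unfolding \<nu>_def using that by (intro integral_distr) auto

  \<comment> \<open>Chebyshev for the empirical laws. This estimate is used twice: for tightness,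
    and for the tail of \<open>\<mu>\<close> after \<open>Y\<close> tends to infinity.\<close>
  have cutoff: "eventually (\<lambda>Y. (LINT x|\<nu> Y. tail_cutoff S x) \<le> 1 * y0 / Y + D T) at_top"
    if T: "T \<ge> 1" and S: "S \<ge> 2 * (\<Sum>n | lam n \<le> T. norm (r n)) + 1" for T S
    using approx_f[OF T] eventually_ge_at_top[of y0]
  proof eventually_elim
    case (elim Y)
    interpret prob_space "uniform_upto Y" using elim y0 by (intro prob_space_uniform_upto) auto
    have P_le: "\<bar>P T y\<bar> \<le> S - 1" for y
      using trig_poly_bound[of r lam y "{n. 0 < lam n \<and> lam n \<le> T}"] S pos
      unfolding P_def partial_trig_sum_def by simp
    have int: "integrable (uniform_upto Y) (\<lambda>y. tail_cutoff S (f y))"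
      by (rule integrable_const_bound[of _ 1]) (auto simp: tail_cutoff_bounds)
    have "ennreal (LINT x|\<nu> Y. tail_cutoff S x) = (\<integral>\<^sup>+y. ennreal (tail_cutoff S (f y)) \<partial>uniform_upto Y)"
      using int by (subst integral_\<nu>) (auto simp: nn_integral_eq_integral tail_cutoff_bounds)
    also have "\<dots> \<le> ennreal (1 * y0 / Y + 0 + 1 * D T)"
      by (rule nn_integral_uniform_upto_le[where P = "P T"])
        (use elim y0 D0 P_le tail_cutoff_le_square in \<open>auto simp: tail_cutoff_bounds\<close>)
    finally show ?case using elim y0 D0[of T] by (subst (asm) ennreal_le_iff) auto
  qed

  have tight: "\<exists>B. eventually (\<lambda>Y. measure (\<nu> Y) {x. \<bar>x\<bar> \<ge> B} < \<epsilon>) at_top" if "\<epsilon> > 0" for \<epsilon>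
  proof -
    have "1 - 2 * \<beta> < 0" "\<epsilon> / 2 > 0" using \<beta> that by auto
    then obtain T where T: "T \<ge> 1" "D T < \<epsilon> / 2" unfolding D_def by (rule powr_small)
    define S where "S = 2 * (\<Sum>n | lam n \<le> T. norm (r n)) + 1"
    have small: "eventually (\<lambda>Y. 1 * y0 / Y < \<epsilon> / 2) at_top"
      using that by (intro order_tendstoD(2)[OF y0Y]) auto
    have "eventually (\<lambda>Y. measure (\<nu> Y) {x. \<bar>x\<bar> \<ge> S} < \<epsilon>) at_top"
      using cutoff[OF T(1) order_refl, folded S_def] small eventually_gt_at_top[of 0]
    proof eventually_elim
      case (elim Y)
      then show ?case using measure_tail_le_cutoff[OF distr, of Y S] T(2) by linarith
    qed
    then show ?thesis by blast
  qed

  have char: "\<exists>L. ((\<lambda>Y. char (\<nu> Y) t) \<longlongrightarrow> L) at_top" for t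
  proof (rule convergent_if_approximable)
    fix e :: real assume e: "e > 0"
    \<comment> \<open>Three of the four parts pay for replacing \<open>f\<close> by
      \<open>P T\<close> (initial stretch, constant term, mean square term), the fourth for the
      convergence of the mean of \<open>iexp (t * P T y)\<close>.\<close>
    define \<delta> where "\<delta> = e / 4"
    have \<delta>: "\<delta> > 0" using e by (simp add: \<delta>_def)
    have "1 - 2 * \<beta> < 0" using \<beta> by simp
    then obtain T where T: "T \<ge> 1" "t^2 / \<delta> * A * T powr (1 - 2 * \<beta>) < \<delta>"
      using \<delta> by (rule powr_small)
    have fin': "finite {n. 0 < lam n \<and> lam n \<le> T}" by (rule finite_subset[OF _ fin[of T]]) auto
    obtain L where L: "((\<lambda>Y. (1 / Y) *\<^sub>R integral {0..Y} (\<lambda>y. iexp (t * P T y))) \<longlongrightarrow> L) at_top"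
      using mean_iexp_trig_poly[OF fin', of t r lam] unfolding P_def partial_trig_sum_def by blast
    have small: "eventually (\<lambda>Y. 2 * y0 / Y < \<delta>) at_top"
      using \<delta> by (intro order_tendstoD(2)[OF y0Y]) auto
    have "eventually (\<lambda>Y. dist (char (\<nu> Y) t) L \<le> e) at_top"
      using approx_f[OF T(1)] eventually_ge_at_top[of y0] small tendstoD[OF L \<delta>]
    proof eventually_elim
      case (elim Y)
      have Y: "Y > 0" using elim y0 by simp
      interpret prob_space "uniform_upto Y" using Y by (rule prob_space_uniform_upto)
      have int: "integrable (uniform_upto Y) (\<lambda>y. iexp (t * g y))"
        if [measurable]: "g \<in> borel_measurable lebesgue" for g
        by (rule integrable_const_bound[of _ 1]) auto
      have "(\<lambda>y. iexp (t * P T y)) absolutely_integrable_on {0..Y}"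
        unfolding P_def by (intro absolutely_integrable_continuous_real continuous_intros)
      from set_lebesgue_integral_eq_integral(2)[OF this]
      have mean: "(LINT y|uniform_upto Y. iexp (t * P T y)) = (1 / Y) *\<^sub>R integral {0..Y} (\<lambda>y. iexp (t * P T y))"
        using Y by (subst integral_uniform_upto) auto
      have ch: "char (\<nu> Y) t = (LINT y|uniform_upto Y. iexp (t * f y))"
        unfolding char_def by (rule integral_\<nu>) measurable
      have "ennreal (norm (char (\<nu> Y) t - (LINT y|uniform_upto Y. iexp (t * P T y)))) =
          ennreal (norm (LINT y|uniform_upto Y. iexp (t * f y) - iexp (t * P T y)))"
        unfolding ch by (subst Bochner_Integration.integral_diff) (rule int f_meas P_meas refl)+
      also have "\<dots> \<le> (\<integral>\<^sup>+y. ennreal (norm (iexp (t * f y) - iexp (t * P T y))) \<partial>uniform_upto Y)"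
        by (intro integral_norm_bound_ennreal Bochner_Integration.integrable_diff int f_meas P_meas)
      also have "\<dots> \<le> ennreal (2 * y0 / Y + \<delta> + t^2 / \<delta> * D T)"
      proof (rule nn_integral_uniform_upto_le[where f = f and P = "P T"])
        fix y
        show "norm (iexp (t * f y) - iexp (t * P T y)) \<le> 2"
          using norm_triangle_ineq4[of "iexp (t * f y)" "iexp (t * P T y)"] by simp
        have "(t * f y - t * P T y)^2 = t^2 * (f y - P T y)^2"
          by (simp add: power_mult_distrib flip: right_diff_distrib)
        then show "norm (iexp (t * f y) - iexp (t * P T y)) \<le> \<delta> + t^2 / \<delta> * (f y - P T y)^2"
          using norm_iexp_diff_le[OF \<delta>, of "t * f y" "t * P T y"] by simp
      qed (use elim y0 D0 \<delta> in auto)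
      finally have "norm (char (\<nu> Y) t - (LINT y|uniform_upto Y. iexp (t * P T y))) \<le> 2 * y0 / Y + \<delta> + t^2 / \<delta> * D T"
        using Y y0 \<delta> D0[of T] by (subst (asm) ennreal_le_iff) auto
      also have "\<dots> \<le> 3 * \<delta>" using elim(3) T(2) unfolding D_def by (simp add: mult.assoc)
      finally have "dist (char (\<nu> Y) t) ((1 / Y) *\<^sub>R integral {0..Y} (\<lambda>y. iexp (t * P T y))) \<le> 3 * \<delta>"
        unfolding mean dist_norm .
      then show ?case
        using dist_triangle[of "char (\<nu> Y) t" L "(1 / Y) *\<^sub>R integral {0..Y} (\<lambda>y. iexp (t * P T y))"] elim(4)
        unfolding \<delta>_def by linarith
    qed
    then show "\<exists>L. eventually (\<lambda>Y. dist (char (\<nu> Y) t) L \<le> e) at_top" by blast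
  qed simp

  obtain \<mu> where \<mu>: "real_distribution \<mu>" and lim: "\<And>g :: real \<Rightarrow> real. continuous_on UNIV g \<Longrightarrow>
      bounded (range g) \<Longrightarrow> ((\<lambda>Y. LINT x|\<nu> Y. g x) \<longlongrightarrow> (LINT x|\<mu>. g x)) at_top"
    using weak_limit_exists[OF distr tight char] by blast
  show ?thesis
  proof (rule that[OF _ A])
    show "limiting_distribution \<phi> \<mu>"
      unfolding limiting_distribution_def
    proof (intro conjI \<mu> allI impI)
      fix g :: "real \<Rightarrow> real" assume g: "continuous_on UNIV g \<and> bounded (range g)"
      have [measurable]: "g \<in> borel_measurable borel" using g by (auto intro: borel_measurable_continuous_onI)
      have "eventually (\<lambda>Y. (LINT x|\<nu> Y. g x) = 1 / Y * (LINT y:{0..Y}|lebesgue. g (\<phi> y))) at_top"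
        using eventually_gt_at_top[of 0]
      proof eventually_elim
        case (elim Y)
        have "(LINT x|\<nu> Y. g x) = (LINT y|uniform_upto Y. g (f y))" by (rule integral_\<nu>) simp
        also have "\<dots> = 1 / Y * (LINT y:{0..Y}|lebesgue. g (f y))"
          using elim by (subst integral_uniform_upto) auto
        also have "(LINT y:{0..Y}|lebesgue. g (f y)) = (LINT y:{0..Y}|lebesgue. g (\<phi> y))"
          by (intro set_lebesgue_integral_cong) (auto simp: f_def)
        finally show ?case .
      qed
      then show "((\<lambda>Y. 1 / Y * (LINT y:{0..Y}|lebesgue. g (\<phi> y))) \<longlongrightarrow> (LINT x|\<mu>. g x)) at_top"
        using lim g by (blast intro: Lim_transform_eventually)
    qed
    fix T S assume T: "T \<ge> 1" and S: "S \<ge> 2 * (\<Sum>n | lam n \<le> T. norm (r n)) + 1"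
    have S0: "S \<ge> 0" using S sum_nonneg[of "{n. lam n \<le> T}" "\<lambda>n. norm (r n)"] by simp
    have lower: "((\<lambda>Y. LINT x|\<nu> Y. tail_cutoff S x) \<longlongrightarrow> (LINT x|\<mu>. tail_cutoff S x)) at_top"
    proof (rule lim[OF continuous_on_tail_cutoff])
      show "bounded (range (tail_cutoff S))"
        using tail_cutoff_bounds by (intro boundedI[of _ 1]) auto
    qed
    have upper: "((\<lambda>Y. 1 * y0 / Y + D T) \<longlongrightarrow> 0 + D T) at_top"
      by (intro tendsto_add y0Y tendsto_const)
    \<comment> \<open>Letting \<open>Y\<close> tend to infinity removes the contribution
      \<open>y0 / Y\<close> of the initial stretch.\<close>
    have "(LINT x|\<mu>. tail_cutoff S x) \<le> 0 + D T"
      by (rule tendsto_le[OF _ upper lower cutoff[OF T S]]) simp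
    moreover have "{..- S} \<union> {S..} = {x. \<bar>x\<bar> \<ge> S}" using S0 by auto
    ultimately show "measure \<mu> ({..- S} \<union> {S..}) \<le> A * T powr (1 - 2 * \<beta>)"
      using measure_tail_le_cutoff[OF \<mu>, of S] unfolding D_def by simp
  qed
qed

section \<open>Tails\<close>

text \<open>The complement of the support is a union of null open sets, so the support is closed;
  the open set outside \<open>[- S, S]\<close> is null, so the support is bounded.\<close>

lemma compactly_supported_if_null_tail:
  fixes \<mu> :: "real measure"
  assumes \<mu>: "real_distribution \<mu>" and null: "measure \<mu> ({..- S} \<union> {S..}) = 0"
  shows "compactly_supported \<mu>"
proof -
  interpret real_distribution \<mu> by fact
  have "closed (measure_support \<mu>)"
    unfolding closed_def
  proof (subst open_subopen, rule ballI)
    fix x assume "x \<in> - measure_support \<mu>"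
    then obtain U where U: "open U" "x \<in> U" "\<not> 0 < emeasure \<mu> U"
      unfolding measure_support_def by auto
    then have "U \<subseteq> - measure_support \<mu>" unfolding measure_support_def by auto
    with U show "\<exists>U. open U \<and> x \<in> U \<and> U \<subseteq> - measure_support \<mu>" by auto
  qed
  moreover have "measure_support \<mu> \<subseteq> {- S..S}"
  proof
    fix x assume x: "x \<in> measure_support \<mu>"
    show "x \<in> {- S..S}"
    proof (rule ccontr)
      assume "x \<notin> {- S..S}"
      then have "x \<in> {..<- S} \<union> {S<..}" by auto
      moreover have "open ({..<- S} \<union> {S<..})" by (intro open_Un open_lessThan open_greaterThan)
      ultimately have "0 < emeasure \<mu> ({..<- S} \<union> {S<..})"
        using x unfolding measure_support_def by blast
      also have "emeasure \<mu> ({..<- S} \<union> {S<..}) \<le> emeasure \<mu> ({..- S} \<union> {S..})"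
        by (intro emeasure_mono) auto
      also have "\<dots> = 0" using null by (simp add: emeasure_eq_measure)
      finally show False by simp
    qed
  qed
  ultimately show ?thesis
    unfolding compactly_supported_def compact_eq_bounded_closed
    using bounded_subset[OF bounded_closed_interval] by (auto simp: cbox_interval)
qed

lemma polynomial_tail:
  fixes q :: "real \<Rightarrow> real"
  assumes \<beta>: "1 / 2 < \<beta>" "\<beta> < 1" and B: "B > 0" and A: "A > 0"
    and q: "\<And>S. q S \<le> 1" "\<And>T S. T \<ge> 1 \<Longrightarrow> S \<ge> B * T powr (1 - \<beta>) + 1 \<Longrightarrow> q S \<le> A * T powr (1 - 2 * \<beta>)"
  shows "\<exists>C>0. \<forall>S\<ge>1. q S \<le> C * S powr (- ((2 * \<beta> - 1) / (2 - 2 * \<beta>)))"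
proof -
  define \<kappa> where "\<kappa> = (2 * \<beta> - 1) / (2 - 2 * \<beta>)"
  define C where "C = A * (2 * B) powr \<kappa> + (B + 2) powr \<kappa>"
  have \<kappa>: "\<kappa> > 0" using \<beta> by (simp add: \<kappa>_def)
  have C: "C > 0" using A B by (simp add: C_def add_pos_pos)
  have "q S \<le> C * S powr (- \<kappa>)" if S: "S \<ge> 1" for S
  \<comment> \<open>For bounded \<open>S\<close> the trivial bound 1 is absorbed by the second
    summand of \<open>C\<close>. Beyond \<open>B + 2\<close> one has both \<open>u \<ge> 1\<close>
    and \<open>S - 1 \<ge> S / 2\<close>.\<close>
  proof (cases "S \<le> B + 2")
    case True
    have "q S \<le> 1" by (rule q)
    also have "1 = S powr \<kappa> * S powr (- \<kappa>)" using S by (simp flip: powr_add)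
    also have "S powr \<kappa> * S powr (- \<kappa>) \<le> (B + 2) powr \<kappa> * S powr (- \<kappa>)"
      using S True \<kappa> by (intro mult_right_mono powr_mono2) auto
    also have "\<dots> \<le> C * S powr (- \<kappa>)" using A B by (intro mult_right_mono) (auto simp: C_def)
    finally show ?thesis .
  next
    case False
    define u where "u = (S - 1) / B"
    \<comment> \<open>The largest admissible \<open>T\<close>, solving
      \<open>B * T powr (1 - \<beta>) + 1 = S\<close>.\<close>
    define T where "T = u powr (1 / (1 - \<beta>))"
    have u: "u \<ge> 1" "u \<ge> S / (2 * B)" using False B by (auto simp: u_def field_simps)
    have "T \<ge> 1" unfolding T_def using u \<beta> by (intro ge_one_powr_ge_zero) auto
    moreover have "B * T powr (1 - \<beta>) + 1 \<le> S"
      unfolding T_def powr_powr using \<beta> u B by (simp add: u_def)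
    ultimately have "q S \<le> A * T powr (1 - 2 * \<beta>)" by (rule q(2))
    also have "T powr (1 - 2 * \<beta>) = u powr (- (2 * \<kappa>))"
      unfolding T_def powr_powr \<kappa>_def using \<beta> by (intro arg_cong2[of _ _ _ _ "(powr)"]) (auto simp: field_simps)
    \<comment> \<open>The choice of \<open>T\<close> gives the exponent \<open>2 * \<kappa>\<close>;
      as \<open>u \<ge> 1\<close> it may be relaxed to \<open>\<kappa>\<close>.\<close>
    also have "A * u powr (- (2 * \<kappa>)) \<le> A * u powr (- \<kappa>)"
      using A u \<kappa> by (intro mult_left_mono powr_mono) auto
    also have "\<dots> \<le> A * (S / (2 * B)) powr (- \<kappa>)"
      using A u \<kappa> S B by (intro mult_left_mono powr_mono2') auto
    also have "\<dots> = A * (2 * B) powr \<kappa> * S powr (- \<kappa>)"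
    proof -
      have "(S / (2 * B)) powr (- \<kappa>) = S powr (- \<kappa>) / (2 * B) powr (- \<kappa>)"
        by (rule powr_divide)
      also have "\<dots> = S powr (- \<kappa>) * (2 * B) powr \<kappa>"
        by (simp only: powr_minus[of "2 * B"] divide_inverse inverse_inverse_eq)
      finally show ?thesis by (simp only: mult_ac)
    qed
    also have "\<dots> \<le> C * S powr (- \<kappa>)" using A B by (intro mult_right_mono) (auto simp: C_def)
    finally show ?thesis .
  qed
  with C show ?thesis unfolding \<kappa>_def by blast
qed

lemma exponential_tail:
  fixes q :: "real \<Rightarrow> real"
  assumes B: "B > 0" and A: "A > 0"
    and q: "\<And>S. q S \<le> 1" "\<And>T S. T \<ge> 1 \<Longrightarrow> S \<ge> B * (1 + ln T) + 1 \<Longrightarrow> q S \<le> A * T powr (- 1)"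
  shows "\<exists>c>0. \<exists>C>0. \<forall>S\<ge>1. q S \<le> C * exp (- c * S)"
proof -
  \<comment> \<open>The factor \<open>exp (1 + 1 / B)\<close> makes the bound at least 1 for
    \<open>S < 1 + B\<close>, where no \<open>T \<ge> 1\<close> is admissible.\<close>
  define C where "C = (A + 1) * exp (1 + 1 / B)"
  have C: "C > 0" using A by (simp add: C_def)
  have "q S \<le> C * exp (- (1 / B) * S)" for S
  proof (cases "S \<ge> 1 + B")
    case True
    \<comment> \<open>The largest admissible \<open>T\<close>, solving
      \<open>B * (1 + ln T) + 1 = S\<close>.\<close>
    define T where "T = exp ((S - 1) / B - 1)"
    have "T \<ge> 1" unfolding T_def using True B by (simp add: field_simps)
    moreover have "B * (1 + ln T) + 1 \<le> S" unfolding T_def using B by simp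
    ultimately have "q S \<le> A * T powr (- 1)" by (rule q(2))
    also have "T powr (- 1) = exp (1 + 1 / B) * exp (- (1 / B) * S)"
      unfolding T_def powr_def exp_add[symmetric] using B by (simp add: field_simps)
    also have "A * (exp (1 + 1 / B) * exp (- (1 / B) * S)) \<le> C * exp (- (1 / B) * S)"
      unfolding C_def mult.assoc by (intro mult_right_mono) auto
    finally show ?thesis .
  next
    case False
    have "q S \<le> 1" by (rule q)
    also have "1 \<le> exp (1 + 1 / B) * exp (- (1 / B) * S)"
    proof -
      have "S / B \<le> (1 + B) / B" using False B by (intro divide_right_mono) auto
      then have "0 \<le> 1 + 1 / B + - (1 / B) * S" using B by (simp add: add_divide_distrib)
      then show ?thesis unfolding exp_add[symmetric] one_le_exp_iff .
    qed
    also have "\<dots> \<le> C * exp (- (1 / B) * S)"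
      unfolding C_def mult.assoc using A by simp
    finally show ?thesis .
  qed
  with C B show ?thesis by (intro exI[of _ "1 / B"] conjI exI[of _ C]) auto
qed

theorem theorem1p10:
  fixes p \<beta> :: real and \<phi> :: "real \<Rightarrow> real"
  assumes "2 \<le> p" and "1 / 2 < \<beta>" and "p_beta_function p \<beta> \<phi>"
  shows "\<exists>\<mu>. limiting_distribution \<phi> \<mu> \<and>
    (\<beta> < 1 \<longrightarrow> (\<exists>C>0. \<forall>S\<ge>1.
       measure \<mu> ({..-S} \<union> {S..}) \<le> C * S powr (- ((2 * \<beta> - 1) / (2 - 2 * \<beta>))))) \<and>
    (\<beta> = 1 \<longrightarrow> (\<exists>c>0. \<exists>C>0. \<forall>S\<ge>1.
       measure \<mu> ({..-S} \<union> {S..}) \<le> C * exp (- c * S))) \<and>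
    (1 < \<beta> \<longrightarrow> compactly_supported \<mu>)"
proof -
  obtain lam r y0 X0 C T0 where exp: "p_function_expansion p \<phi> lam r y0 X0"
    and C: "C > 0" "T0 > 0" and block: "\<And>T. T \<ge> T0 \<Longrightarrow>
      (\<Sum>n | T \<le> lam n \<and> lam n \<le> T + 1. norm (r n)) \<le> C * T powr (- \<beta>)"
    using assms(3) unfolding p_beta_function_def by blast
  have pos: "lam n > 0" for n using exp unfolding p_function_expansion_def by blast
  have fin: "finite {n. lam n \<le> X}" for X
  proof -
    have "filterlim lam at_top sequentially" using exp unfolding p_function_expansion_def by blast
    then have "eventually (\<lambda>n. X < lam n) sequentially" unfolding filterlim_at_top_dense by blast
    then obtain N where "\<And>n. n \<ge> N \<Longrightarrow> X < lam n" unfolding eventually_sequentially by blast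
    then have "{n. lam n \<le> X} \<subseteq> {..<N}" by (auto simp: not_le[symmetric])
    then show ?thesis by (rule finite_subset) simp
  qed
  have "\<beta> > 0" using assms(2) by simp
  obtain K where K: "K > 0"
    and bd: "\<And>k. (\<Sum>n | nat \<lfloor>lam n\<rfloor> = k. norm (r n)) \<le> K * (real k + 1) powr (- \<beta>)"
    using block_bound[OF pos fin \<open>\<beta> > 0\<close> C block] by blast
  obtain \<mu> A where \<mu>: "limiting_distribution \<phi> \<mu>" and A: "A > 0" and tail:
    "\<And>T S. T \<ge> 1 \<Longrightarrow> S \<ge> 2 * (\<Sum>n | lam n \<le> T. norm (r n)) + 1 \<Longrightarrow>
       measure \<mu> ({..- S} \<union> {S..}) \<le> A * T powr (1 - 2 * \<beta>)"
    using limiting_distribution_with_tail[OF exp assms(1) fin K assms(2) bd] by blast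
  have dist: "real_distribution \<mu>" using \<mu> unfolding limiting_distribution_def by blast
  interpret real_distribution \<mu> by (rule dist)
  note sums = sum_coeffs_le[OF pos fin K bd]
  have "\<exists>C>0. \<forall>S\<ge>1. measure \<mu> ({..- S} \<union> {S..}) \<le> C * S powr (- ((2 * \<beta> - 1) / (2 - 2 * \<beta>)))"
    if "\<beta> < 1"
  proof (rule polynomial_tail[OF assms(2) that _ A prob_le_1])
    \<comment> \<open>Twice the constant for the coefficient mass, because a partial sum is twice a
      real part.\<close>
    show "4 * K / (1 - \<beta>) > 0" using K that by simp
    fix T S assume "T \<ge> 1" "4 * K / (1 - \<beta>) * T powr (1 - \<beta>) + 1 \<le> S"
    with sums(1)[OF \<open>T \<ge> 1\<close> \<open>\<beta> > 0\<close> that]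
    show "measure \<mu> ({..- S} \<union> {S..}) \<le> A * T powr (1 - 2 * \<beta>)" by (intro tail) auto
  qed
  moreover have "\<exists>c>0. \<exists>C>0. \<forall>S\<ge>1. measure \<mu> ({..- S} \<union> {S..}) \<le> C * exp (- c * S)"
    if "\<beta> = 1"
  proof (rule exponential_tail[OF _ A prob_le_1])
    show "4 * K > 0" using K by simp
    fix T S assume "T \<ge> 1" "4 * K * (1 + ln T) + 1 \<le> S"
    with sums(2)[OF \<open>T \<ge> 1\<close> that] tail[of T S]
    show "measure \<mu> ({..- S} \<union> {S..}) \<le> A * T powr (- 1)" unfolding that by simp
  qed
  moreover have "compactly_supported \<mu>" if "\<beta> > 1"
  proof (rule compactly_supported_if_null_tail[OF dist])
    \<comment> \<open>For \<open>\<beta> > 1\<close> the partial sums are bounded independently of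
      \<open>T\<close>. One \<open>S\<close> thus serves all \<open>T\<close>, and letting
      \<open>T\<close> grow forces the tail mass to be 0.\<close>
    define S where "S = 2 * (K * (1 + 1 / (\<beta> - 1))) + 1"
    have le: "measure \<mu> ({..- S} \<union> {S..}) \<le> A * T powr (1 - 2 * \<beta>)" if "T \<ge> 1" for T
      using sums(3)[OF that \<open>\<beta> > 1\<close>] that by (intro tail) (auto simp: S_def)
    show "measure \<mu> ({..- S} \<union> {S..}) = 0"
    proof (rule ccontr)
      assume "measure \<mu> ({..- S} \<union> {S..}) \<noteq> 0"
      then have "measure \<mu> ({..- S} \<union> {S..}) > 0" by (simp add: zero_less_measure_iff)
      moreover have "1 - 2 * \<beta> < 0" using assms(2) by simp
      ultimately obtain T where "T \<ge> 1" "A * T powr (1 - 2 * \<beta>) < measure \<mu> ({..- S} \<union> {S..})"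
        using powr_small by blast
      with le[of T] show False by simp
    qed
  qed
  ultimately show ?thesis using \<mu> by blast
qed

end
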